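(* Let $\{\pi_k\}_{k\ge0}$ be the sequence of policies generated by PMD with mirror map $h(p)=\sum_a\psi(p(a))$ and a constant step size $\eta>0$. Assume $\psi'(0^+)>-\infty$ and $\psi'(1^-)=+\infty$, let $\pi_\infty=\lim_{k\to\infty}\pi_k$ be the limiting policy (which exists under these conditions), and assume $\mathcal S_{=1}\ne\emptyset$. If $\psi$ is twice continuously differentiable on $\mathrm{int}\,\mathrm{dom}\,\psi$ and $0<\psi''(x)<+\infty$ for all $x\in\mathrm{int}\,\mathrm{dom}\,\psi$, then: (a) for any $s\in\mathcal S_{=1}$ and $\sigma\in(0,\Delta/2)$, $$\forall\,k\ge T_1(\sigma):\quad\|\pi_k(\cdot|s)-\pi_\infty(\cdot|s)\|_\infty\le b_s^{\pi_k}\le\chi^{-1}\big(k\eta(\Delta_{=1}-2\sigma)+C_1(\sigma)\big);$$ (b) for any $s\in\mathcal S_{>1}$ there are strictly positive finite constants $U_s$ and $L_s$, depending on the limiting policy $\pi_\infty(\cdot|s)$ and the second derivative $\psi''$, such that for any $\sigma\in(0,\Delta/2)$ there exists a finite time $T_3(\sigma)$ with $$\forall\,k\ge T_3(\sigma):\quad\|\pi_k(\cdot|s)-\pi_\infty(\cdot|s)\|_\infty\le\frac{U_s}{L_s}\,b_s^{\pi_k}+\frac{2\eta U_s}{L_s^2}(1+|\mathcal A|)\sum_{t=k}^\infty\|V^*-V^{\pi_t}\|_\infty.$$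
   Context: MDP: $(\mathcal S,\mathcal A,P,r,\gamma)$ is a finite discounted Markov decision process: finite state space $\mathcal S$, finite action space $\mathcal A$, transition model $P(\cdot|s,a)\in\Delta(\mathcal S)$, reward $r:\mathcal S\times\mathcal A\to[0,1]$, discount $\gamma\in[0,1)$. $\Delta(\mathcal X)$ is the probability simplex over a finite set $\mathcal X$. A policy $\pi$ assigns to each $s$ a distribution $\pi(\cdot|s)\in\Delta(\mathcal A)$; $\Pi$ is the set of all policies. $V^\pi(s)$ is the expected value of $\sum_{t\ge0}\gamma^t r(s_t,a_t)$ given $s_0=s$, $a_t\sim\pi(\cdot|s_t)$, $s_{t+1}\sim P(\cdot|s_t,a_t)$, and $Q^\pi(s,a)$ is the same conditioned on $(s_0,a_0)=(s,a)$. $V^*(s)=\max_{\pi\in\Pi}V^\pi(s)$, $Q^*(s,a)=\max_{\pi\in\Pi}Q^\pi(s,a)$. $\mathcal A^*_s=\{a: Q^*(s,a)=V^*(s)\}$, $\mathcal S_{=1}=\{s:|\mathcal A_s^*|=1\}$, $\mathcal S_{>1}=\{s:|\mathcal A_s^*|>1\}$, $\tilde{\mathcal S}=\{s:\mathcal A_s^*\ne\mathcal A\}$, the last assumed nonempty throughout (so $|\mathcal A|\ge 2$ and $\mathcal S_{=1}\subseteq\tilde{\mathcal S}$). For $s\in\tilde{\mathcal S}$, $\Delta_s=V^*(s)-\max_{a'\notin\mathcal A_s^*}Q^*(s,a')$; $\Delta=\min_{s\in\tilde{\mathcal S}}\Delta_s>0$ (a number; not to be confused with the simplex $\Delta(\cdot)$)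 and $\Delta_{=1}=\min_{s\in\mathcal S_{=1}}\Delta_s$. $b_s^\pi=\sum_{a'\notin\mathcal A_s^*}\pi(a'|s)$. Mirror map: $\psi:\mathbb R\to(-\infty,+\infty]$ satisfies: (a) $\mathrm{dom}\,\psi\supseteq[0,1]$; (b) $\psi$ is proper, closed and convex; (c) $\psi$ is differentiable on $\mathrm{int}\,\mathrm{dom}\,\psi$ and $|\psi'(x_n)|\to\infty$ for every sequence $\{x_n\}\subseteq\mathrm{int}\,\mathrm{dom}\,\psi$ converging to a boundary point of $\mathrm{dom}\,\psi$; (d) $\psi$ is strictly convex on $\mathrm{int}\,\mathrm{dom}\,\psi$. $\psi'(0^+)$ and $\psi'(1^-)$ are the one-sided limits of $\psi'$ at $0$ from the right and at $1$ from the left. $h(p)=\sum_{a\in\mathcal A}\psi(p(a))$ and $D_h(p\|q)=h(p)-h(q)-\langle\nabla h(q),p-q\rangle$. PMD: given $\eta>0$ and an initial policy $\pi_0$ with $\pi_0(a|s)\in\mathrm{int}\,\mathrm{dom}\,\psi$ for all $(s,a)$ (assumed throughout), for each $s$, $\pi_{k+1}(\cdot|s)=\arg\max_{p\in\Delta(\mathcal A)}\{\eta\langle p,Q^{\pi_k}(s,\cdot)\rangle-D_h(p\|\pi_k(\cdot|s))\}$; all iterates satisfy $\pi_k(a|s)\in\mathrm{int}\,\mathrm{dom}\,\psi$. Constants: $\chi(x):=\psi'(1-x)$ is a continuous strictly decreasing map of $(0,1]$ onto $[\psi'(0^+),+\infty)$ with inverse $\chi^{-1}$. $T(\sigma):=\min\{k:\|V^*-V^{\pi_k}\|_\infty\le\sigma\}$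 (finite). For $s\in\tilde{\mathcal S}$, $G_k(s):=\min_{a^*\in\mathcal A_s^*}\psi'(\pi_k(a^*|s))-\max_{a'\notin\mathcal A_s^*}\psi'(\pi_k(a'|s))$. $C_1(\sigma):=\min_{s\in\mathcal S_{=1}}\{\psi'(0)+G_{T(\sigma)}(s)-\eta T(\sigma)(\Delta_{=1}-2\sigma)\}$. $T_1(\sigma):=\max\{\tilde T(\sigma),\max_{\tilde s\in\mathcal S_{>1}}T_{\mathrm{stop}}(\tilde s)\}$, where $\tilde T(\sigma)\ge T(\sigma)$ is an integer such that $C_1(\sigma)+k\eta(\Delta_{=1}-2\sigma)\ge\psi'(0)$ for all $k\ge\tilde T(\sigma)$, and, for each $\tilde s\in\mathcal S_{>1}$, $T_{\mathrm{stop}}(\tilde s)$ is a finite time (which exists in this setting) such that $b_{\tilde s}^{\pi_k}=0$ for all $k\ge T_{\mathrm{stop}}(\tilde s)$. *)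

theory Defs
  imports "HOL-Probability.Probability"
begin

section \<open>Laws of homogeneous Markov chains\<close>

definition chain_kernel ::
    "'x pmf \<Rightarrow> ('x \<Rightarrow> 'x pmf) \<Rightarrow> nat \<Rightarrow> (nat \<Rightarrow> 'x) \<Rightarrow> 'x measure" where
  "chain_kernel \<mu> K n \<omega> = measure_pmf (case n of 0 \<Rightarrow> \<mu> | Suc m \<Rightarrow> K (\<omega> m))"

lemma Ionescu_Tulcea_chain_kernel:
  "Ionescu_Tulcea (chain_kernel \<mu> K) (\<lambda>_. count_space UNIV)"
proof (rule Ionescu_Tulcea.intro)
  fix n :: nat
  have "(\<lambda>\<omega>. measure_pmf (K (\<omega> m)))
      \<in> measurable (PiM {0..<Suc m} (\<lambda>_. count_space UNIV)) (subprob_algebra (count_space UNIV))" for m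
    by (rule measurable_compose[where g = "\<lambda>x. measure_pmf (K x)" and f = "\<lambda>\<omega>. \<omega> m",
          OF measurable_component_singleton measurable_measure_pmf]) simp
  moreover have "(\<lambda>\<omega>. measure_pmf \<mu>)
      \<in> measurable (PiM {0..<0} (\<lambda>_. count_space UNIV)) (subprob_algebra (count_space UNIV))"
    by (rule measurable_const) (simp add: measure_pmf_in_subprob_algebra)
  ultimately show "chain_kernel \<mu> K n
      \<in> measurable (PiM {0..<n} (\<lambda>_. count_space UNIV)) (subprob_algebra (count_space UNIV))"
    unfolding chain_kernel_def by (cases n) simp_all
next
  fix n :: nat and \<omega> :: "nat \<Rightarrow> 'a"
  show "prob_space (chain_kernel \<mu> K n \<omega>)"
    unfolding chain_kernel_def by (rule prob_space_measure_pmf)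
qed

text \<open>The Ionescu-Tulcea measure on sequences: the law of the chain with initial distribution
  \<open>\<mu>\<close> and one-step transition kernel \<open>K\<close>.\<close>

definition chain_law :: "'x pmf \<Rightarrow> ('x \<Rightarrow> 'x pmf) \<Rightarrow> (nat \<Rightarrow> 'x) measure" where
  "chain_law \<mu> K = projective_family.lim UNIV
     (Ionescu_Tulcea.CI (chain_kernel \<mu> K) (\<lambda>_. count_space UNIV)) (\<lambda>_. count_space UNIV)"

section \<open>Finite discounted Markov decision processes\<close>

record ('s, 'a) mdp =
  transition :: "'s \<Rightarrow> 'a \<Rightarrow> 's pmf"
  reward :: "'s \<Rightarrow> 'a \<Rightarrow> real"
  discount :: real

definition discounted_mdp :: "('s::finite, 'a::finite) mdp \<Rightarrow> bool" where
  "discounted_mdp M \<longleftrightarrow>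
     (\<forall>s a. reward M s a \<in> {0..1}) \<and> discount M \<in> {0..<1}"

definition prob_simplex :: "(real ^ 'a::finite) set" where
  "prob_simplex = {p. (\<forall>a. 0 \<le> p $ a) \<and> (\<Sum>a\<in>UNIV. p $ a) = 1}"

type_synonym ('s, 'a) policy = "'s \<Rightarrow> real ^ 'a"

definition policies :: "('s::finite, 'a::finite) policy set" where
  "policies = {\<pi>. \<forall>s. \<pi> s \<in> prob_simplex}"

definition action_pmf :: "('s::finite, 'a::finite) policy \<Rightarrow> 's \<Rightarrow> 'a pmf" where
  "action_pmf \<pi> s = embed_pmf (\<lambda>a. \<pi> s $ a)"

definition start_at :: "('s::finite, 'a::finite) policy \<Rightarrow> 's \<Rightarrow> ('s \<times> 'a) pmf" where
  "start_at \<pi> s = map_pmf (\<lambda>a. (s, a)) (action_pmf \<pi> s)"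

definition step :: "('s::finite, 'a::finite) mdp \<Rightarrow> ('s, 'a) policy \<Rightarrow> 's \<times> 'a \<Rightarrow> ('s \<times> 'a) pmf" where
  "step M \<pi> = (\<lambda>(s, a). transition M s a \<bind> start_at \<pi>)"

definition discounted_return :: "('s::finite, 'a::finite) mdp \<Rightarrow> (nat \<Rightarrow> 's \<times> 'a) \<Rightarrow> real" where
  "discounted_return M \<omega> = (\<Sum>t. discount M ^ t * reward M (fst (\<omega> t)) (snd (\<omega> t)))"

definition V :: "('s::finite, 'a::finite) mdp \<Rightarrow> ('s, 'a) policy \<Rightarrow> 's \<Rightarrow> real" where
  "V M \<pi> s = (LINT \<omega>|chain_law (start_at \<pi> s) (step M \<pi>). discounted_return M \<omega>)"

text \<open>Conditioning on \<open>(s\<^sub>0, a\<^sub>0) = (s, a)\<close> means starting the chain there, which makes sense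
  also when \<open>\<pi>(a|s) = 0\<close>.\<close>

definition Q :: "('s::finite, 'a::finite) mdp \<Rightarrow> ('s, 'a) policy \<Rightarrow> 's \<Rightarrow> 'a \<Rightarrow> real" where
  "Q M \<pi> s a = (LINT \<omega>|chain_law (return_pmf (s, a)) (step M \<pi>). discounted_return M \<omega>)"

definition V_opt :: "('s::finite, 'a::finite) mdp \<Rightarrow> 's \<Rightarrow> real" where
  "V_opt M s = (SUP \<pi>\<in>policies. V M \<pi> s)"

definition Q_opt :: "('s::finite, 'a::finite) mdp \<Rightarrow> 's \<Rightarrow> 'a \<Rightarrow> real" where
  "Q_opt M s a = (SUP \<pi>\<in>policies. Q M \<pi> s a)"

definition opt_actions :: "('s::finite, 'a::finite) mdp \<Rightarrow> 's \<Rightarrow> 'a set" where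
  "opt_actions M s = {a. Q_opt M s a = V_opt M s}"

definition S_unique :: "('s::finite, 'a::finite) mdp \<Rightarrow> 's set" where
  "S_unique M = {s. card (opt_actions M s) = 1}"

definition S_multi :: "('s::finite, 'a::finite) mdp \<Rightarrow> 's set" where
  "S_multi M = {s. card (opt_actions M s) > 1}"

definition S_tilde :: "('s::finite, 'a::finite) mdp \<Rightarrow> 's set" where
  "S_tilde M = {s. opt_actions M s \<noteq> UNIV}"

definition gap :: "('s::finite, 'a::finite) mdp \<Rightarrow> 's \<Rightarrow> real" where
  "gap M s = V_opt M s - Max (Q_opt M s ` (- opt_actions M s))"

definition min_gap :: "('s::finite, 'a::finite) mdp \<Rightarrow> real" where
  "min_gap M = Min (gap M ` S_tilde M)"

definition min_gap_unique :: "('s::finite, 'a::finite) mdp \<Rightarrow> real" where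
  "min_gap_unique M = Min (gap M ` S_unique M)"

definition subopt_mass :: "('s::finite, 'a::finite) mdp \<Rightarrow> ('s, 'a) policy \<Rightarrow> 's \<Rightarrow> real" where
  "subopt_mass M \<pi> s = (\<Sum>a\<in>- opt_actions M s. \<pi> s $ a)"

definition value_error :: "('s::finite, 'a::finite) mdp \<Rightarrow> ('s, 'a) policy \<Rightarrow> real" where
  "value_error M \<pi> = infnorm (\<chi> s. V_opt M s - V M \<pi> s)"

section \<open>Mirror maps\<close>

definition edom :: "(real \<Rightarrow> ereal) \<Rightarrow> real set" where
  "edom \<psi> = {x. \<psi> x < \<infinity>}"

definition ereal_epigraph :: "(real \<Rightarrow> ereal) \<Rightarrow> (real \<times> real) set" where
  "ereal_epigraph \<psi> = {(x, t). \<psi> x \<le> ereal t}"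

definition strictly_convex_on :: "real set \<Rightarrow> (real \<Rightarrow> real) \<Rightarrow> bool" where
  "strictly_convex_on S f \<longleftrightarrow> convex S \<and>
     (\<forall>x\<in>S. \<forall>y\<in>S. \<forall>t\<in>{0<..<1}. x \<noteq> y \<longrightarrow>
        f ((1 - t) * x + t * y) < (1 - t) * f x + t * f y)"

definition dpsi :: "(real \<Rightarrow> ereal) \<Rightarrow> real \<Rightarrow> real" where
  "dpsi \<psi> = deriv (\<lambda>x. real_of_ereal (\<psi> x))"

definition d2psi :: "(real \<Rightarrow> ereal) \<Rightarrow> real \<Rightarrow> real" where
  "d2psi \<psi> = deriv (dpsi \<psi>)"

definition dpsi_right :: "(real \<Rightarrow> ereal) \<Rightarrow> real \<Rightarrow> ereal" where
  "dpsi_right \<psi> c = Lim (at_right c) (\<lambda>x. ereal (dpsi \<psi> x))"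

definition dpsi_left :: "(real \<Rightarrow> ereal) \<Rightarrow> real \<Rightarrow> ereal" where
  "dpsi_left \<psi> c = Lim (at_left c) (\<lambda>x. ereal (dpsi \<psi> x))"

definition mirror_map :: "(real \<Rightarrow> ereal) \<Rightarrow> bool" where
  "mirror_map \<psi> \<longleftrightarrow>
     {0..1} \<subseteq> edom \<psi> \<and>
     (\<forall>x. \<psi> x \<noteq> -\<infinity>) \<and> edom \<psi> \<noteq> {} \<and>
     closed (ereal_epigraph \<psi>) \<and> convex (ereal_epigraph \<psi>) \<and>
     (\<forall>x\<in>interior (edom \<psi>). (\<lambda>x. real_of_ereal (\<psi> x)) differentiable at x) \<and>
     (\<forall>X x. (\<forall>n::nat. X n \<in> interior (edom \<psi>)) \<and> X \<longlonglongrightarrow> x \<and> x \<in> frontier (edom \<psi>) \<longrightarrow>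
        filterlim (\<lambda>n. \<bar>dpsi \<psi> (X n)\<bar>) at_top sequentially) \<and>
     strictly_convex_on (interior (edom \<psi>)) (\<lambda>x. real_of_ereal (\<psi> x))"

definition separable :: "(real \<Rightarrow> ereal) \<Rightarrow> real ^ 'a::finite \<Rightarrow> ereal" where
  "separable \<psi> p = (\<Sum>a\<in>UNIV. \<psi> (p $ a))"

definition grad :: "('v::real_inner \<Rightarrow> real) \<Rightarrow> 'v \<Rightarrow> 'v" where
  "grad f x = (THE g. GDERIV f x :> g)"

text \<open>Only used for \<open>p\<close> in the probability simplex, where \<open>h p\<close> is finite, and for \<open>q\<close> with all
  components in \<open>interior (edom \<psi>)\<close>.\<close>

definition bregman :: "('v::real_inner \<Rightarrow> ereal) \<Rightarrow> 'v \<Rightarrow> 'v \<Rightarrow> real" where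
  "bregman h p q = real_of_ereal (h p) - real_of_ereal (h q)
     - inner (grad (\<lambda>x. real_of_ereal (h x)) q) (p - q)"

section \<open>Policy mirror descent with constant step size\<close>

definition pmd ::
    "('s::finite, 'a::finite) mdp \<Rightarrow> (real \<Rightarrow> ereal) \<Rightarrow> real \<Rightarrow> (nat \<Rightarrow> ('s, 'a) policy) \<Rightarrow> bool" where
  "pmd M \<psi> \<eta> \<pi> \<longleftrightarrow>
     \<pi> 0 \<in> policies \<and> (\<forall>s a. \<pi> 0 s $ a \<in> interior (edom \<psi>)) \<and>
     (\<forall>k s. is_arg_max
        (\<lambda>p. \<eta> * inner p (\<chi> a. Q M (\<pi> k) s a) - bregman (separable \<psi>) p (\<pi> k s))
        (\<lambda>p. p \<in> prob_simplex) (\<pi> (Suc k) s))"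

definition chi_inv :: "(real \<Rightarrow> ereal) \<Rightarrow> real \<Rightarrow> real" where
  "chi_inv \<psi> = the_inv_into {0<..1} (\<lambda>x. dpsi \<psi> (1 - x))"

definition T_hit ::
    "('s::finite, 'a::finite) mdp \<Rightarrow> (nat \<Rightarrow> ('s, 'a) policy) \<Rightarrow> real \<Rightarrow> nat" where
  "T_hit M \<pi> \<sigma> = (LEAST k. value_error M (\<pi> k) \<le> \<sigma>)"

definition G ::
    "('s::finite, 'a::finite) mdp \<Rightarrow> (real \<Rightarrow> ereal) \<Rightarrow> ('s, 'a) policy \<Rightarrow> 's \<Rightarrow> real" where
  "G M \<psi> \<pi> s = Min ((\<lambda>a. dpsi \<psi> (\<pi> s $ a)) ` opt_actions M s)
     - Max ((\<lambda>a. dpsi \<psi> (\<pi> s $ a)) ` (- opt_actions M s))"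

definition C1 ::
    "('s::finite, 'a::finite) mdp \<Rightarrow> (real \<Rightarrow> ereal) \<Rightarrow> real \<Rightarrow> (nat \<Rightarrow> ('s, 'a) policy) \<Rightarrow> real \<Rightarrow> real" where
  "C1 M \<psi> \<eta> \<pi> \<sigma> = Min ((\<lambda>s. dpsi \<psi> 0 + G M \<psi> (\<pi> (T_hit M \<pi> \<sigma>)) s
     - \<eta> * real (T_hit M \<pi> \<sigma>) * (min_gap_unique M - 2 * \<sigma>)) ` S_unique M)"

text \<open>The times \<open>T_stop(s)\<close> and \<open>T_tilde(\<sigma>)\<close> are not unique: any number with the
  following property is admissible.\<close>

definition is_T_tilde ::
    "('s::finite, 'a::finite) mdp \<Rightarrow> (real \<Rightarrow> ereal) \<Rightarrow> real \<Rightarrow> (nat \<Rightarrow> ('s, 'a) policy) \<Rightarrow> real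
      \<Rightarrow> nat \<Rightarrow> bool" where
  "is_T_tilde M \<psi> \<eta> \<pi> \<sigma> T \<longleftrightarrow> T_hit M \<pi> \<sigma> \<le> T \<and>
     (\<forall>k\<ge>T. dpsi \<psi> 0 \<le> C1 M \<psi> \<eta> \<pi> \<sigma> + real k * \<eta> * (min_gap_unique M - 2 * \<sigma>))"

definition is_T_stop ::
    "('s::finite, 'a::finite) mdp \<Rightarrow> (nat \<Rightarrow> ('s, 'a) policy) \<Rightarrow> 's \<Rightarrow> nat \<Rightarrow> bool" where
  "is_T_stop M \<pi> s T \<longleftrightarrow> (\<forall>k\<ge>T. subopt_mass M (\<pi> k) s = 0)"

definition T1 ::
    "('s::finite, 'a::finite) mdp \<Rightarrow> nat \<Rightarrow> ('s \<Rightarrow> nat) \<Rightarrow> nat" where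
  "T1 M T_tilde T_stop = Max (insert T_tilde (T_stop ` S_multi M))"

definition limit_policy :: "(nat \<Rightarrow> ('s::finite, 'a::finite) policy) \<Rightarrow> ('s, 'a) policy" where
  "limit_policy \<pi> s = lim (\<lambda>k. \<pi> k s)"

end

theory Submission
  imports Defs
begin

text \<open>
  Everything is read off from the dual iterates \<open>\<psi>'(\<pi>\<^sub>k(a|s))\<close>. Steepness at \<open>1\<close> keeps every
  iterate below \<open>1\<close>, and the finite slope at \<open>0\<close> puts \<open>0\<close> into the interior of the domain
  of \<open>\<psi>\<close>; so \<open>\<psi>'\<close> is finite and strictly increasing on all probabilities that occur, zero
  included. The optimality condition of a mirror step (\<open>prox_multiplier\<close>) says that the dual iterate
  of every action moves by \<open>\<eta> Q\<close> plus a number common to all actions, or by at least that much if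
  the new probability of the action is \<open>0\<close>.

  The values converge summably fast (\<open>summable_value_error\<close>). By the three-point inequality for the
  Bregman divergence and the performance difference identity, the partial sums
  \<open>S\<^sub>n = \<Sum>\<^sub>k\<^sub><\<^sub>n V\<^sup>* - V\<^sup>\<pi>\<^sup>k\<close> satisfy
  \<open>S\<^sub>n \<le> C + \<gamma> P S\<^sub>n\<close> with \<open>P\<close> the transition operator of an optimal policy and \<open>C\<close>
  independent of \<open>n\<close>: both the divergences to the optimal policy and the one-step improvements of the
  value telescope. Hence \<open>S\<^sub>n \<le> C / (1 - \<gamma>)\<close>.

  Once the value error is small, the dual value of an optimal action gains at least a fixed amount
  per step on each suboptimal action of positive probability, and as an action of probability \<open>0\<close> has
  the smallest possible dual value, the advantage over all suboptimal actions grows linearly as long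
  as they carry any mass (\<open>dual_gap_growth\<close>). If the optimal action is unique, they always carry
  mass, because no probability reaches \<open>1\<close>; the dual value of the optimal action, \<open>\<psi>'(1 - b)\<close>
  with \<open>b\<close> the suboptimal mass, then grows linearly, and inverting \<open>\<psi>'\<close> bounds \<open>b\<close>
  (\<open>unique_rate\<close>). If there are two optimal actions, one of them has probability at most \<open>1/2\<close>
  and hence a bounded dual value, so the suboptimal mass vanishes after finitely many steps, and it
  stays zero (\<open>T_stop_exists\<close>).

  From then on probability only moves among optimal actions, whose \<open>Q\<close>-values agree up to the value
  error. Conservation of mass pins down the common multiplier up to the same error, so each dual
  iterate moves by at most \<open>\<eta>\<close> times the value error (\<open>dual_increment_bound\<close>). Summability makes
  the dual iterates converge, with the tail sum as rate; as their limits are finite, the limiting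
  probabilities are below \<open>1\<close>, and the slope \<open>\<psi>''\<close> of \<open>\<psi>'\<close> at these limits carries the
  rate over to the policies (\<open>multi_rate\<close>). The constants \<open>L\<close> and \<open>U\<close> are the least and the
  largest value of \<open>\<psi>''\<close> at the limiting probabilities.
\<close>

section \<open>Time marginals and discounted sums of a Markov chain\<close>

definition state_law :: "'x pmf \<Rightarrow> ('x \<Rightarrow> 'x pmf) \<Rightarrow> nat \<Rightarrow> 'x pmf" where
  "state_law \<mu> K n = ((\<lambda>p. p \<bind> K) ^^ n) \<mu>"

lemma state_law_0 [simp]: "state_law \<mu> K 0 = \<mu>"
  and state_law_Suc: "state_law \<mu> K (Suc n) = state_law \<mu> K n \<bind> K"
  by (simp_all add: state_law_def)

lemma state_law_Suc_shift: "state_law \<mu> K (Suc n) = state_law (\<mu> \<bind> K) K n"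
  by (simp add: state_law_def funpow_Suc_right del: funpow.simps)

lemma state_law_bind: "state_law \<mu> K n = \<mu> \<bind> (\<lambda>x. state_law (return_pmf x) K n)"
  by (induction n) (simp_all add: state_law_Suc bind_return_pmf' bind_assoc_pmf)

text \<open>
  The finite-dimensional marginals of \<open>chain_law\<close> are the measures \<open>C\<close> of the Ionescu-Tulcea
  construction, so identifying the law of their last coordinate identifies every one-time marginal
  of the chain. The induction integrates out one kernel at a time.
\<close>

lemma nn_integral_last_coordinate:
  fixes f :: "'x \<Rightarrow> ennreal"
  shows "(\<integral>\<^sup>+\<omega>. f (\<omega> n) \<partial>Ionescu_Tulcea.C (chain_kernel \<mu> K) (\<lambda>_. count_space UNIV) 0 (Suc n) (\<lambda>_. undefined))
       = (\<integral>\<^sup>+x. f x \<partial>state_law \<mu> K n)"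
proof -
  interpret IT: Ionescu_Tulcea "chain_kernel \<mu> K" "\<lambda>_. count_space UNIV"
    by (rule Ionescu_Tulcea_chain_kernel)
  let ?w = "\<lambda>_::nat. undefined :: 'x"
  have w: "?w \<in> space (PiM {0..<0} (\<lambda>_. count_space UNIV))" by (simp add: space_PiM)
  have step: "(\<integral>\<^sup>+\<omega>. f (\<omega> n) \<partial>IT.C 0 (Suc n) ?w)
      = (\<integral>\<^sup>+\<omega>. (\<integral>\<^sup>+x. f x \<partial>chain_kernel \<mu> K n \<omega>) \<partial>IT.C 0 n ?w)" for f :: "'x \<Rightarrow> ennreal" and n
  proof -
    have m: "(\<lambda>\<omega>. f (\<omega> n)) \<in> borel_measurable (PiM {0..<Suc n} (\<lambda>_. count_space UNIV))"
      by (rule measurable_compose[OF measurable_component_singleton]) simp_all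
    have "(\<integral>\<^sup>+\<omega>. f (\<omega> n) \<partial>IT.C 0 (Suc n) ?w)
      = (\<integral>\<^sup>+\<omega>. (\<integral>\<^sup>+\<omega>'. f (\<omega>' n) \<partial>IT.eP n \<omega>) \<partial>IT.C 0 n ?w)"
      using m IT.measurable_eP[of n] IT.sets_C[OF w, of n]
      by (auto intro!: nn_integral_bind[where B = "PiM {0..<Suc n} (\<lambda>_. count_space UNIV)"]
            simp: measurable_cong_sets[OF IT.sets_C[OF w, of n] refl])
    also have "\<dots> = (\<integral>\<^sup>+\<omega>. (\<integral>\<^sup>+x. f x \<partial>chain_kernel \<mu> K n \<omega>) \<partial>IT.C 0 n ?w)"
      using IT.space_C[OF w, of n] m by (intro nn_integral_cong) (simp add: IT.nn_integral_eP)
    finally show ?thesis .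
  qed
  show ?thesis
  proof (induction n arbitrary: f)
    case 0
    have "emeasure (IT.C 0 0 ?w) (space (IT.C 0 0 ?w)) = 1"
      by (rule prob_space.emeasure_space_1[OF IT.prob_space_C[OF w]])
    then show ?case unfolding step
      by (simp add: chain_kernel_def del: IT.C.simps)
  next
    case (Suc n)
    have "chain_kernel \<mu> K (Suc n) \<omega> = measure_pmf (K (\<omega> n))" for \<omega>
      by (simp add: chain_kernel_def)
    then show ?case unfolding step[of "Suc n" f]
      using Suc[of "\<lambda>y. \<integral>\<^sup>+x. f x \<partial>K y"]
      by (simp add: state_law_Suc del: IT.C.simps)
  qed
qed

lemma
  shows sets_chain_law [measurable_cong]:
      "sets (chain_law \<mu> K) = sets (PiM UNIV (\<lambda>_. count_space UNIV))"
    and distr_chain_law: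
      "distr (chain_law \<mu> K) (count_space UNIV) (\<lambda>\<omega>. \<omega> n) = measure_pmf (state_law \<mu> K n)"
proof -
  interpret IT: Ionescu_Tulcea "chain_kernel \<mu> K" "\<lambda>_. count_space UNIV"
    by (rule Ionescu_Tulcea_chain_kernel)
  let ?w = "\<lambda>_::nat. undefined :: 'a"
  let ?M = "\<lambda>J. PiM J (\<lambda>_. count_space UNIV) :: (nat \<Rightarrow> 'a) measure"
  let ?J = "{0..<Suc n}"
  have w: "?w \<in> space (?M {0..<0})" by (simp add: space_PiM)
  have eq: "chain_law \<mu> K = IT.PF.lim" by (simp add: chain_law_def)
  show s: "sets (chain_law \<mu> K) = sets (?M UNIV)" by (simp add: eq)
  have coord: "(\<lambda>\<omega>. \<omega> n) \<in> measurable (?M ?J) (count_space UNIV)"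
    by (rule measurable_component_singleton) simp
  have restr: "(\<lambda>\<omega>. restrict \<omega> ?J) \<in> measurable (?M UNIV) (?M ?J)"
    by (rule measurable_restrict_subset) simp
  have restr': "(\<lambda>\<omega>. restrict \<omega> ?J) \<in> measurable (?M ?J) (?M ?J)"
    by (rule measurable_restrict_subset) simp
  have up: "IT.up_to ?J = Suc n"
    by (intro antisym) (simp_all add: IT.up_to_iff Suc_le_eq IT.up_to_less)
  have "distr (chain_law \<mu> K) (count_space UNIV) (\<lambda>\<omega>. \<omega> n)
      = distr (distr (chain_law \<mu> K) (?M ?J) (\<lambda>\<omega>. restrict \<omega> ?J)) (count_space UNIV) (\<lambda>\<omega>. \<omega> n)"
    using coord restr by (subst distr_distr) (simp_all add: measurable_cong_sets[OF s refl] comp_def)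
  also have "\<dots> = distr (IT.CI ?J) (count_space UNIV) (\<lambda>\<omega>. \<omega> n)"
    by (simp only: eq IT.distr_lim finite_atLeastLessThan)
  also have "\<dots> = distr (IT.C 0 (Suc n) ?w) (count_space UNIV) (\<lambda>\<omega>. \<omega> n)"
    unfolding IT.CI_def up using coord restr' IT.sets_C[OF w, of "Suc n"]
    by (subst distr_distr) (simp_all add: measurable_cong_sets[OF IT.sets_C[OF w, of "Suc n"] refl] comp_def del: IT.C.simps)
  also have "\<dots> = measure_pmf (state_law \<mu> K n)"
  proof (rule measure_eqI)
    fix A
    have m: "(\<lambda>\<omega>. \<omega> n) \<in> measurable (IT.C 0 (Suc n) ?w) (count_space UNIV)"
      using coord IT.sets_C[OF w, of "Suc n"]
      by (simp add: measurable_cong_sets[OF IT.sets_C[OF w, of "Suc n"] refl] del: IT.C.simps)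
    have "emeasure (distr (IT.C 0 (Suc n) ?w) (count_space UNIV) (\<lambda>\<omega>. \<omega> n)) A
        = (\<integral>\<^sup>+x. indicator A x \<partial>distr (IT.C 0 (Suc n) ?w) (count_space UNIV) (\<lambda>\<omega>. \<omega> n))"
      by (simp del: IT.C.simps)
    also have "\<dots> = (\<integral>\<^sup>+\<omega>. indicator A (\<omega> n) \<partial>IT.C 0 (Suc n) ?w)"
      by (rule nn_integral_distr[OF m]) simp
    also have "\<dots> = emeasure (measure_pmf (state_law \<mu> K n)) A"
      by (subst nn_integral_last_coordinate) simp
    finally show "emeasure (distr (IT.C 0 (Suc n) ?w) (count_space UNIV) (\<lambda>\<omega>. \<omega> n)) A
        = emeasure (measure_pmf (state_law \<mu> K n)) A" .
  qed simp
  finally show "distr (chain_law \<mu> K) (count_space UNIV) (\<lambda>\<omega>. \<omega> n) = measure_pmf (state_law \<mu> K n)" .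
qed

lemma measurable_chain_coordinate [measurable]:
  "(\<lambda>\<omega>. \<omega> n) \<in> measurable (chain_law \<mu> K) (count_space UNIV)"
  by (simp add: measurable_cong_sets[OF sets_chain_law refl])

lemma prob_space_chain_law: "prob_space (chain_law \<mu> K)"
  by (rule prob_space_distrD[of "\<lambda>\<omega>. \<omega> 0" _ "count_space UNIV"])
    (simp_all add: distr_chain_law prob_space_measure_pmf)

text \<open>
  The expected discounted return, with the expectation already taken time by time. It is kept for an
  arbitrary initial distribution \<open>\<mu>\<close> because both Bellman equations are statements about how
  it depends on \<open>\<mu>\<close>.
\<close>

definition discounted_sum :: "real \<Rightarrow> ('x \<Rightarrow> real) \<Rightarrow> ('x \<Rightarrow> 'x pmf) \<Rightarrow> 'x pmf \<Rightarrow> real" where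
  "discounted_sum \<gamma> r K \<mu> = (\<Sum>t. \<gamma> ^ t * measure_pmf.expectation (state_law \<mu> K t) r)"

context
  fixes \<gamma> :: real and r :: "'x::finite \<Rightarrow> real" and K :: "'x \<Rightarrow> 'x pmf"
  assumes \<gamma>: "0 \<le> \<gamma>" "\<gamma> < 1" and r: "\<And>x. 0 \<le> r x" "\<And>x. r x \<le> 1"
begin

lemma integrable_r: "integrable (measure_pmf p) r"
  by (rule measure_pmf.integrable_const_bound[where B = 1]) (use r in auto)

lemma expectation_bounds:
  "0 \<le> measure_pmf.expectation p r" "measure_pmf.expectation p r \<le> 1"
  using r integrable_r[of p] by (auto intro!: measure_pmf.integral_le_const)

lemma summable_disc: "summable (\<lambda>t. \<gamma> ^ t * measure_pmf.expectation (state_law \<mu> K t) r)"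
  by (rule summable_comparison_test'[OF summable_geometric[of \<gamma>], of 0])
    (use \<gamma> expectation_bounds in \<open>auto simp: abs_mult mult_left_le\<close>)

lemma integral_chain_law:
  "(LINT \<omega>|chain_law \<mu> K. (\<Sum>t. \<gamma> ^ t * r (\<omega> t))) = discounted_sum \<gamma> r K \<mu>"
proof -
  interpret prob_space "chain_law \<mu> K" by (rule prob_space_chain_law)
  have m [measurable]: "(\<lambda>\<omega>. r (\<omega> t)) \<in> borel_measurable (chain_law \<mu> K)" for t
    by (rule measurable_compose[OF measurable_chain_coordinate]) simp
  have i: "integrable (chain_law \<mu> K) (\<lambda>\<omega>. \<gamma> ^ t * r (\<omega> t))" for t
    by (intro integrable_mult_right integrable_const_bound[where B = 1]) (use r in auto)
  have ex: "(LINT \<omega>|chain_law \<mu> K. r (\<omega> t)) = measure_pmf.expectation (state_law \<mu> K t) r" for t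
    unfolding distr_chain_law[symmetric] by (rule integral_distr[symmetric]) simp_all
  have "(LINT \<omega>|chain_law \<mu> K. (\<Sum>t. \<gamma> ^ t * r (\<omega> t))) = (\<Sum>t. LINT \<omega>|chain_law \<mu> K. \<gamma> ^ t * r (\<omega> t))"
  proof (rule integral_suminf[OF i])
    show "AE \<omega> in chain_law \<mu> K. summable (\<lambda>t. norm (\<gamma> ^ t * r (\<omega> t)))"
      by (intro always_eventually allI summable_comparison_test'[OF summable_geometric[of \<gamma>], of 0])
        (use \<gamma> r in \<open>auto simp: abs_mult mult_left_le\<close>)
    show "summable (\<lambda>t. LINT \<omega>|chain_law \<mu> K. norm (\<gamma> ^ t * r (\<omega> t)))"
      using summable_disc[of \<mu>] \<gamma> r by (simp add: abs_mult ex)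
  qed
  then show ?thesis by (simp add: ex discounted_sum_def)
qed

text \<open>
  The state laws are mixtures over the starting point, so the discounted sum is affine in the initial
  distribution: this is the Bellman equation that expresses \<open>V\<close> through \<open>Q\<close>.
\<close>

lemma discounted_sum_bind:
  fixes \<nu> :: "'y::finite pmf"
  shows "discounted_sum \<gamma> r K (\<nu> \<bind> f) = (\<Sum>y\<in>UNIV. pmf \<nu> y * discounted_sum \<gamma> r K (f y))"
proof -
  have "state_law (\<nu> \<bind> f) K t = \<nu> \<bind> (\<lambda>y. state_law (f y) K t)" for t
    by (subst (1 2) state_law_bind) (simp add: bind_assoc_pmf)
  then have "measure_pmf.expectation (state_law (\<nu> \<bind> f) K t) r
      = (\<Sum>y\<in>UNIV. pmf \<nu> y * measure_pmf.expectation (state_law (f y) K t) r)" for t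
    by (simp add: pmf_expectation_bind[of UNIV])
  then have "discounted_sum \<gamma> r K (\<nu> \<bind> f)
      = (\<Sum>t. \<Sum>y\<in>UNIV. pmf \<nu> y * (\<gamma> ^ t * measure_pmf.expectation (state_law (f y) K t) r))"
    unfolding discounted_sum_def by (simp add: sum_distrib_left mult.left_commute)
  also have "\<dots> = (\<Sum>y\<in>UNIV. pmf \<nu> y * discounted_sum \<gamma> r K (f y))"
    unfolding discounted_sum_def
    by (subst suminf_sum) (simp_all add: summable_mult summable_disc suminf_mult)
  finally show ?thesis .
qed

text \<open>
  Splitting off time \<open>0\<close> gives the Bellman equation that expresses \<open>Q\<close> through \<open>V\<close>.
\<close>

lemma discounted_sum_step: "discounted_sum \<gamma> r K \<mu> = measure_pmf.expectation \<mu> r + \<gamma> * discounted_sum \<gamma> r K (\<mu> \<bind> K)"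
  unfolding discounted_sum_def using suminf_split_head[OF summable_disc[of \<mu>]]
  by (simp add: state_law_Suc_shift mult.assoc suminf_mult[OF summable_disc])

end

section \<open>Bellman equations and optimal policies\<close>

lemma finite_type_max_attained:
  fixes f :: "'x::finite \<Rightarrow> real" shows "\<exists>x. \<forall>y. f y \<le> f x"
proof -
  have "Max (range f) \<in> range f" by (rule Max_in) simp_all
  then obtain x where "Max (range f) = f x" by blast
  then have "f y \<le> f x" for y by (metis Max_ge finite_code rangeI finite_imageI)
  then show ?thesis by blast
qed

definition next_val :: "('s::finite, 'a::finite) mdp \<Rightarrow> ('s \<Rightarrow> real) \<Rightarrow> 's \<Rightarrow> 'a \<Rightarrow> real" where
  "next_val M f s a = (\<Sum>s'\<in>UNIV. pmf (transition M s a) s' * f s')"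

lemma prob_simplexD:
  assumes "p \<in> prob_simplex"
  shows "0 \<le> p $ a" "(\<Sum>a\<in>UNIV. p $ a) = 1" "p $ a \<le> 1"
proof -
  show "0 \<le> p $ a" "(\<Sum>a\<in>UNIV. p $ a) = 1" using assms by (auto simp: prob_simplex_def)
  show "p $ a \<le> 1"
    using member_le_sum[of a UNIV "\<lambda>a. p $ a"] assms by (auto simp: prob_simplex_def)
qed

lemma policiesD: "\<pi> \<in> policies \<Longrightarrow> \<pi> s \<in> prob_simplex"
  by (simp add: policies_def)

lemma simplex_average_le:
  assumes "p \<in> prob_simplex" "\<And>a. f a \<le> c"
  shows "(\<Sum>a\<in>UNIV. p $ a * f a) \<le> c"
proof -
  have "(\<Sum>a\<in>UNIV. p $ a * f a) \<le> (\<Sum>a\<in>UNIV. p $ a * c)"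
    by (intro sum_mono mult_left_mono assms prob_simplexD(1))
  then show ?thesis by (simp add: sum_distrib_right[symmetric] prob_simplexD(2)[OF assms(1)])
qed

lemma next_val_le: "(\<And>s'. f s' \<le> c) \<Longrightarrow> next_val M f s a \<le> c"
proof -
  assume "\<And>s'. f s' \<le> c"
  then have "next_val M f s a \<le> (\<Sum>s'\<in>UNIV. pmf (transition M s a) s' * c)"
    unfolding next_val_def by (intro sum_mono mult_left_mono) simp_all
  then show ?thesis by (simp add: sum_distrib_right[symmetric] sum_pmf_eq_1)
qed

lemma next_val_diff: "next_val M f s a - next_val M h s a = next_val M (\<lambda>s. f s - h s) s a"
  by (simp add: next_val_def sum_subtractf[symmetric] algebra_simps)

lemma next_val_minus: "next_val M (\<lambda>s. - f s) s a = - next_val M f s a"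
  by (simp add: next_val_def sum_negf)

lemma next_val_sum: "(\<Sum>k\<in>A. next_val M (f k) s a) = next_val M (\<lambda>s. \<Sum>k\<in>A. f k s) s a"
  unfolding next_val_def sum_distrib_left by (rule sum.swap)

lemma pmf_action:
  assumes "\<pi> \<in> policies" shows "pmf (action_pmf \<pi> s) a = \<pi> s $ a"
  unfolding action_pmf_def
proof (rule pmf_embed_pmf)
  show "0 \<le> \<pi> s $ x" for x using policiesD[OF assms] by (rule prob_simplexD)
  have "(\<integral>\<^sup>+ x. ennreal (\<pi> s $ x) \<partial>count_space UNIV) = (\<Sum>x\<in>UNIV. ennreal (\<pi> s $ x))"
    by (rule nn_integral_count_space_finite) simp
  also have "\<dots> = ennreal (\<Sum>x\<in>UNIV. \<pi> s $ x)"
    by (rule sum_ennreal) (rule prob_simplexD(1)[OF policiesD[OF assms]])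
  finally show "(\<integral>\<^sup>+ x. ennreal (\<pi> s $ x) \<partial>count_space UNIV) = 1"
    by (simp add: prob_simplexD(2)[OF policiesD[OF assms]])
qed

locale finite_mdp =
  fixes M :: "('s::finite, 'a::finite) mdp"
  assumes M: "discounted_mdp M"
begin

abbreviation \<gamma> where "\<gamma> \<equiv> discount M"

lemma \<gamma>: "0 \<le> \<gamma>" "\<gamma> < 1" using M by (auto simp: discounted_mdp_def)

lemma reward: "0 \<le> reward M s a" "reward M s a \<le> 1"
  using M by (auto simp: discounted_mdp_def)

abbreviation (input) "rew \<equiv> \<lambda>x. reward M (fst x) (snd x)"

lemma V_discounted_sum: "V M \<pi> s = discounted_sum \<gamma> rew (step M \<pi>) (start_at \<pi> s)"
  and Q_discounted_sum: "Q M \<pi> s a = discounted_sum \<gamma> rew (step M \<pi>) (return_pmf (s, a))"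
  unfolding V_def Q_def discounted_return_def
  by (rule integral_chain_law; use \<gamma> reward in auto)+

lemma V_eq:
  assumes "\<pi> \<in> policies" shows "V M \<pi> s = (\<Sum>a\<in>UNIV. \<pi> s $ a * Q M \<pi> s a)"
  unfolding V_discounted_sum Q_discounted_sum start_at_def map_pmf_def
  using \<gamma> reward by (subst discounted_sum_bind) (auto simp: pmf_action[OF assms])

lemma Q_eq: "Q M \<pi> s a = reward M s a + \<gamma> * next_val M (V M \<pi>) s a"
proof -
  have "discounted_sum \<gamma> rew (step M \<pi>) (return_pmf (s, a) \<bind> step M \<pi>) = next_val M (V M \<pi>) s a"
    unfolding next_val_def V_discounted_sum
    using \<gamma> reward by (subst discounted_sum_bind[symmetric]) (auto simp: bind_return_pmf step_def)
  then show ?thesis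
    unfolding Q_discounted_sum using \<gamma> reward by (subst discounted_sum_step) auto
qed

lemma Q_diff: "Q M \<mu> s a - Q M \<pi> s a = \<gamma> * next_val M (\<lambda>s. V M \<mu> s - V M \<pi> s) s a"
  unfolding next_val_diff[symmetric] by (simp add: Q_eq algebra_simps)

text \<open>
  Evaluating the hypothesis at a state where \<open>X\<close> is maximal gives \<open>max X \<le> c + \<gamma> max X\<close>,
  since an average of \<open>X\<close> does not exceed its maximum. For \<open>c = 0\<close> this is a maximum principle.
\<close>

lemma contraction_bound:
  assumes "\<mu> \<in> policies"
    and X: "\<And>s. X s \<le> c + \<gamma> * (\<Sum>a\<in>UNIV. \<mu> s $ a * next_val M X s a)"
  shows "X s \<le> c / (1 - \<gamma>)"
proof -
  define m where "m = Max (range X)"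
  have "X s \<le> m" for s by (simp add: m_def)
  then have "(\<Sum>a\<in>UNIV. \<mu> s $ a * next_val M X s a) \<le> m" for s
    by (intro simplex_average_le next_val_le policiesD[OF assms(1)])
  then have "X s \<le> c + \<gamma> * m" for s
    using X[of s] \<gamma> by (meson add_left_mono mult_left_mono order_trans)
  then have "m \<le> c + \<gamma> * m" by (simp add: m_def)
  then have "m \<le> c / (1 - \<gamma>)" using \<gamma> by (simp add: field_simps)
  with \<open>X s \<le> m\<close> show ?thesis by simp
qed

text \<open>
  The Bellman form of the performance difference lemma: comparing two policies one step at a time
  avoids discounted visitation distributions.
\<close>

lemma performance_difference:
  assumes "\<mu> \<in> policies"
  shows "V M \<mu> s - V M \<pi> s =
    \<gamma> * (\<Sum>a\<in>UNIV. \<mu> s $ a * next_val M (\<lambda>s. V M \<mu> s - V M \<pi> s) s a)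
    + ((\<Sum>a\<in>UNIV. \<mu> s $ a * Q M \<pi> s a) - V M \<pi> s)"
proof -
  have "(\<Sum>a\<in>UNIV. \<mu> s $ a * Q M \<mu> s a) - (\<Sum>a\<in>UNIV. \<mu> s $ a * Q M \<pi> s a)
      = (\<Sum>a\<in>UNIV. \<mu> s $ a * (Q M \<mu> s a - Q M \<pi> s a))"
    by (simp add: sum_subtractf right_diff_distrib)
  also have "\<dots> = \<gamma> * (\<Sum>a\<in>UNIV. \<mu> s $ a * next_val M (\<lambda>s. V M \<mu> s - V M \<pi> s) s a)"
    unfolding Q_diff sum_distrib_left by (simp add: mult.left_commute)
  finally show ?thesis unfolding V_eq[OF assms] by simp
qed

text \<open>
  If \<open>\<mu>\<close> improves on \<open>\<pi>\<close> in the first step at every state, the maximum principle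
  makes \<open>V\<^sup>\<mu> - V\<^sup>\<pi>\<close> nonnegative; the discounted term of the performance difference is then
  nonnegative too, so the one-step improvement is a lower bound for the full one.
\<close>

lemma policy_improvement:
  assumes "\<mu> \<in> policies" and imp: "\<And>s. V M \<pi> s \<le> (\<Sum>a\<in>UNIV. \<mu> s $ a * Q M \<pi> s a)"
  shows "V M \<pi> s \<le> V M \<mu> s"
    and "(\<Sum>a\<in>UNIV. \<mu> s $ a * Q M \<pi> s a) - V M \<pi> s \<le> V M \<mu> s - V M \<pi> s"
proof -
  let ?X = "\<lambda>s. V M \<mu> s - V M \<pi> s"
  have neg: "- ?X s \<le> 0 / (1 - \<gamma>)" for s
  proof (rule contraction_bound[OF assms(1), where X = "\<lambda>s. - ?X s"])
    fix s show "- ?X s \<le> 0 + \<gamma> * (\<Sum>a\<in>UNIV. \<mu> s $ a * next_val M (\<lambda>s. - ?X s) s a)"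
      unfolding next_val_minus using performance_difference[OF assms(1), of s \<pi>] imp[of s]
      by (simp add: sum_negf)
  qed
  then show "V M \<pi> s \<le> V M \<mu> s" by simp
  have "next_val M (\<lambda>s. - ?X s) s a \<le> 0" for a
    by (rule next_val_le) (use neg in simp)
  from simplex_average_le[OF policiesD[OF assms(1)], OF this, of s]
  have "- (\<Sum>a\<in>UNIV. \<mu> s $ a * next_val M ?X s a) \<le> 0"
    unfolding next_val_minus by (simp add: sum_negf)
  then have "0 \<le> \<gamma> * (\<Sum>a\<in>UNIV. \<mu> s $ a * next_val M ?X s a)" using \<gamma> by simp
  then show "(\<Sum>a\<in>UNIV. \<mu> s $ a * Q M \<pi> s a) - V M \<pi> s \<le> V M \<mu> s - V M \<pi> s"
    using performance_difference[OF assms(1), of s \<pi>] by linarith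
qed

definition det_policy :: "('s \<Rightarrow> 'a) \<Rightarrow> ('s, 'a) policy" where
  "det_policy d s = axis (d s) 1"

lemma sum_axis: "(\<Sum>a\<in>UNIV. axis b (1::real) $ a * f a) = f b"
  by (simp add: axis_def if_distrib[of "\<lambda>x. x * _"] cong: if_cong)

lemma det_policy: "det_policy d \<in> policies"
  using sum_axis[of _ "\<lambda>_. 1"] by (auto simp: policies_def prob_simplex_def det_policy_def axis_def)

text \<open>
  Among the finitely many deterministic policies take one with the largest sum of values. Its greedy
  policy is at least as good at every state, hence equally good at every state, so the one-step
  improvement is zero: no action beats the policy's own value. This gives a solution of the optimality
  equation without a fixed point argument.
\<close>

lemma exists_greedy_consistent_policy: "\<exists>\<rho>\<in>policies. \<forall>s a. Q M \<rho> s a \<le> V M \<rho> s"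
proof -
  let ?W = "\<lambda>d. \<Sum>s\<in>UNIV. V M (det_policy d) s"
  obtain d where d: "\<And>d'. ?W d' \<le> ?W d"
    using finite_type_max_attained[of ?W] by blast
  obtain d' where d': "\<And>s a. Q M (det_policy d) s a \<le> Q M (det_policy d) s (d' s)"
    using finite_type_max_attained[of "Q M (det_policy d) _"] by metis
  have V: "V M (det_policy d) s = Q M (det_policy d) s (d s)" for s
    by (subst V_eq[OF det_policy]) (simp add: det_policy_def sum_axis)
  have Qd': "(\<Sum>a\<in>UNIV. det_policy d' s $ a * Q M (det_policy d) s a) = Q M (det_policy d) s (d' s)" for s
    by (simp add: det_policy_def sum_axis)
  note imp = policy_improvement[OF det_policy[of d'], of "det_policy d", unfolded Qd', unfolded V, OF d', folded V]
  have "(\<Sum>s\<in>UNIV. V M (det_policy d') s - V M (det_policy d) s) = 0"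
    using d[of d'] imp(1) by (intro antisym sum_nonneg) (simp_all add: sum_subtractf)
  then have "V M (det_policy d') s = V M (det_policy d) s" for s
    using imp(1) by (subst (asm) sum_nonneg_eq_0_iff) auto
  then have "Q M (det_policy d) s (d' s) \<le> V M (det_policy d) s" for s
    using imp(2)[of s] by simp
  with d' show ?thesis by (meson det_policy order_trans)
qed

text \<open>
  A policy that no single action can improve is optimal at all states simultaneously, by
  the maximum principle. Hence the suprema defining \<open>V\<^sup>*\<close> and \<open>Q\<^sup>*\<close> are attained by one and the
  same policy.
\<close>

lemma optimal_policy:
  obtains \<rho> where "\<rho> \<in> policies" "V_opt M = V M \<rho>" "Q_opt M = Q M \<rho>"
    "\<And>s a. Q_opt M s a \<le> V_opt M s" "\<And>\<mu> s. \<mu> \<in> policies \<Longrightarrow> V M \<mu> s \<le> V_opt M s"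
proof -
  obtain \<rho> where \<rho>: "\<rho> \<in> policies" and le: "\<And>s a. Q M \<rho> s a \<le> V M \<rho> s"
    using exists_greedy_consistent_policy by blast
  have V: "V M \<mu> s \<le> V M \<rho> s" if \<mu>: "\<mu> \<in> policies" for \<mu> s
  proof -
    have "V M \<mu> s - V M \<rho> s \<le> 0 / (1 - \<gamma>)" for s
    proof (rule contraction_bound[OF \<mu>, where X = "\<lambda>s. V M \<mu> s - V M \<rho> s"])
      fix s show "V M \<mu> s - V M \<rho> s
          \<le> 0 + \<gamma> * (\<Sum>a\<in>UNIV. \<mu> s $ a * next_val M (\<lambda>s. V M \<mu> s - V M \<rho> s) s a)"
        using performance_difference[OF \<mu>, of s \<rho>] le
          simplex_average_le[OF policiesD[OF \<mu>], of "Q M \<rho> s" "V M \<rho> s" s] by simp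
    qed
    then show ?thesis by (simp add: field_simps)
  qed
  have Q: "Q M \<mu> s a \<le> Q M \<rho> s a" if \<mu>: "\<mu> \<in> policies" for \<mu> s a
    using Q_diff[of \<mu> s a \<rho>] V[OF \<mu>] next_val_le[of "\<lambda>s. V M \<mu> s - V M \<rho> s" 0 M s a] \<gamma>
      mult_nonneg_nonpos[of \<gamma>] by fastforce
  have "V_opt M s = V M \<rho> s" for s
    unfolding V_opt_def using \<rho> V by (intro cSup_eq_maximum) auto
  moreover have "Q_opt M s a = Q M \<rho> s a" for s a
    unfolding Q_opt_def using \<rho> Q by (intro cSup_eq_maximum) auto
  ultimately have "V_opt M = V M \<rho>" "Q_opt M = Q M \<rho>" by (intro ext; blast)+
  with le V show ?thesis by (intro that[OF \<rho>]) auto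
qed

lemma V_opt_upper: "\<pi> \<in> policies \<Longrightarrow> V M \<pi> s \<le> V_opt M s"
  by (rule optimal_policy)

lemma Q_opt_le_V_opt: "Q_opt M s a \<le> V_opt M s"
  by (rule optimal_policy)

lemma Q_opt_diff: "Q_opt M s a - Q M \<pi> s a = \<gamma> * next_val M (\<lambda>s. V_opt M s - V M \<pi> s) s a"
  by (rule optimal_policy) (simp add: Q_diff)

lemma opt_actions_nonempty: "opt_actions M s \<noteq> {}"
proof -
  obtain \<rho> where \<rho>: "\<rho> \<in> policies" "V_opt M = V M \<rho>" "Q_opt M = Q M \<rho>"
    by (rule optimal_policy)
  obtain b where b: "\<And>a. Q_opt M s a \<le> Q_opt M s b"
    using finite_type_max_attained[of "Q_opt M s"] by blast
  have "V_opt M s \<le> Q_opt M s b"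
    using simplex_average_le[OF policiesD[OF \<rho>(1)], of "Q_opt M s" _ s, OF b] V_eq[OF \<rho>(1)] \<rho>(2,3) by simp
  with Q_opt_le_V_opt[of s b] show ?thesis by (auto simp: opt_actions_def)
qed

lemma gap_pos_and_bound:
  assumes "s \<in> S_tilde M"
  shows "0 < gap M s" and "a \<notin> opt_actions M s \<Longrightarrow> Q_opt M s a \<le> V_opt M s - gap M s"
proof -
  have ne: "- opt_actions M s \<noteq> {}" using assms by (auto simp: S_tilde_def)
  then have "Max (Q_opt M s ` (- opt_actions M s)) \<in> Q_opt M s ` (- opt_actions M s)"
    by (intro Max_in) simp_all
  then obtain b where b: "b \<notin> opt_actions M s" "Max (Q_opt M s ` (- opt_actions M s)) = Q_opt M s b"
    by auto
  with Q_opt_le_V_opt[of s b] show "0 < gap M s" by (simp add: gap_def opt_actions_def)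
  show "Q_opt M s a \<le> V_opt M s - gap M s" if "a \<notin> opt_actions M s"
    using that by (simp add: gap_def)
qed

lemma value_error_ge: "\<bar>V_opt M s - V M \<pi> s\<bar> \<le> value_error M \<pi>"
  unfolding value_error_def
  using component_le_infnorm_cart[of "\<chi> s. V_opt M s - V M \<pi> s" s] by simp

lemma infnorm_le_cart:
  fixes x :: "real ^ 'n" shows "(\<And>i. \<bar>x $ i\<bar> \<le> B) \<Longrightarrow> infnorm x \<le> B"
  unfolding infnorm_cart by (rule cSup_least) auto

lemma value_error_le: "(\<And>s. \<bar>V_opt M s - V M \<pi> s\<bar> \<le> B) \<Longrightarrow> value_error M \<pi> \<le> B"
  unfolding value_error_def by (rule infnorm_le_cart) simp

lemma Q_error_bounds:
  assumes "\<pi> \<in> policies"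
  shows "Q M \<pi> s a \<le> Q_opt M s a" and "Q_opt M s a \<le> Q M \<pi> s a + value_error M \<pi>"
proof -
  let ?d = "next_val M (\<lambda>s. V_opt M s - V M \<pi> s) s a"
  have "next_val M (\<lambda>s. - (V_opt M s - V M \<pi> s)) s a \<le> 0"
    by (rule next_val_le) (use V_opt_upper[OF assms] in simp)
  then have 0: "0 \<le> ?d" unfolding next_val_minus by simp
  have "?d \<le> value_error M \<pi>"
    by (rule next_val_le) (use value_error_ge in \<open>simp add: abs_le_iff\<close>)
  moreover have "\<gamma> * ?d \<le> ?d" using 0 \<gamma> by (simp add: mult_left_le_one_le)
  ultimately show "Q M \<pi> s a \<le> Q_opt M s a" "Q_opt M s a \<le> Q M \<pi> s a + value_error M \<pi>"
    using Q_opt_diff[of s a \<pi>] mult_nonneg_nonneg[OF \<gamma>(1) 0] by linarith+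
qed

end

section \<open>Mirror maps with finite slope at 0 and infinite slope at 1\<close>

locale steep_mirror_map =
  fixes \<psi> :: "real \<Rightarrow> ereal"
  assumes mirror: "mirror_map \<psi>"
    and slope_0: "-\<infinity> < dpsi_right \<psi> 0" and slope_1: "dpsi_left \<psi> 1 = \<infinity>"
    and dpsi_differentiable: "\<And>x. x \<in> interior (edom \<psi>) \<Longrightarrow> dpsi \<psi> differentiable at x"
    and d2psi_pos: "\<And>x. x \<in> interior (edom \<psi>) \<Longrightarrow> 0 < d2psi \<psi> x"
begin

abbreviation I where "I \<equiv> interior (edom \<psi>)"

definition psir :: "real \<Rightarrow> real" where "psir x = real_of_ereal (\<psi> x)"

lemma unit_edom: "0 \<le> x \<Longrightarrow> x \<le> 1 \<Longrightarrow> x \<in> edom \<psi>"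
  using mirror by (auto simp: mirror_map_def)

lemma psi_eq_psir: "x \<in> edom \<psi> \<Longrightarrow> \<psi> x = ereal (psir x)"
  using mirror unfolding mirror_map_def edom_def psir_def by (cases "\<psi> x") auto

lemma I_edom: "x \<in> I \<Longrightarrow> x \<in> edom \<psi>"
  using interior_subset by blast

lemma convex_psir: "convex_on (edom \<psi>) psir"
proof -
  have *: "u * x + v * y \<in> edom \<psi> \<and> psir (u * x + v * y) \<le> u * psir x + v * psir y"
    if "x \<in> edom \<psi>" "y \<in> edom \<psi>" "0 \<le> u" "0 \<le> v" "u + v = 1" for x y u v
  proof -
    have "(x, psir x) \<in> ereal_epigraph \<psi>" "(y, psir y) \<in> ereal_epigraph \<psi>"
      using that psi_eq_psir by (auto simp: ereal_epigraph_def)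
    moreover have "convex (ereal_epigraph \<psi>)" using mirror by (simp add: mirror_map_def)
    ultimately have "u *\<^sub>R (x, psir x) + v *\<^sub>R (y, psir y) \<in> ereal_epigraph \<psi>"
      using that by (intro convexD) auto
    then have le: "\<psi> (u * x + v * y) \<le> ereal (u * psir x + v * psir y)"
      by (simp add: ereal_epigraph_def)
    then have "u * x + v * y \<in> edom \<psi>" by (auto simp: edom_def order_le_less_trans)
    with le psi_eq_psir show ?thesis by simp
  qed
  then show ?thesis by (auto simp: convex_on_def convex_def)
qed

lemma convex_edom: "convex (edom \<psi>)" using convex_psir by (simp add: convex_on_def)

lemma convex_I: "convex I" by (intro convex_interior convex_edom)

lemma between_I: "x \<in> I \<Longrightarrow> z \<in> I \<Longrightarrow> x \<le> y \<Longrightarrow> y \<le> z \<Longrightarrow> y \<in> I"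
  using convex_I unfolding is_interval_convex_1[symmetric] is_interval_1 by blast

lemma psir_deriv: "x \<in> I \<Longrightarrow> (psir has_real_derivative dpsi \<psi> x) (at x)"
  using mirror unfolding mirror_map_def dpsi_def psir_def[abs_def]
  by (metis DERIV_deriv_iff_real_differentiable)

lemma dpsi_deriv: "x \<in> I \<Longrightarrow> (dpsi \<psi> has_real_derivative d2psi \<psi> x) (at x)"
  unfolding d2psi_def by (metis DERIV_deriv_iff_real_differentiable dpsi_differentiable)

lemma dpsi_continuous: "x \<in> I \<Longrightarrow> isCont (dpsi \<psi>) x"
  using dpsi_deriv DERIV_isCont by blast

lemma dpsi_less: "x \<in> I \<Longrightarrow> y \<in> I \<Longrightarrow> x < y \<Longrightarrow> dpsi \<psi> x < dpsi \<psi> y"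
  by (rule DERIV_pos_imp_increasing) (auto intro: dpsi_deriv d2psi_pos between_I)

lemma dpsi_less_iff: "x \<in> I \<Longrightarrow> y \<in> I \<Longrightarrow> dpsi \<psi> x < dpsi \<psi> y \<longleftrightarrow> x < y"
  and dpsi_le_iff: "x \<in> I \<Longrightarrow> y \<in> I \<Longrightarrow> dpsi \<psi> x \<le> dpsi \<psi> y \<longleftrightarrow> x \<le> y"
  using dpsi_less[of x y] dpsi_less[of y x] by (cases x y rule: linorder_cases; force)+

lemma tangent: "c \<in> I \<Longrightarrow> x \<in> edom \<psi> \<Longrightarrow> dpsi \<psi> c * (x - c) \<le> psir x - psir c"
  by (rule convex_on_imp_above_tangent[OF convex_psir])
    (auto intro: convex_connected convex_edom has_field_derivative_at_within psir_deriv)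

lemma open_unit_I: "0 < x \<Longrightarrow> x < 1 \<Longrightarrow> x \<in> I"
  by (rule interiorI[of "{0<..<1}"]) (auto intro: unit_edom)

lemma blowup:
  assumes "\<And>n::nat. X n \<in> I" "X \<longlonglongrightarrow> x" "x \<in> edom \<psi>" "x \<notin> I"
  shows "filterlim (\<lambda>n. \<bar>dpsi \<psi> (X n)\<bar>) at_top sequentially"
proof -
  have "x \<in> frontier (edom \<psi>)"
    using assms(3,4) closure_subset by (auto simp: frontier_def)
  with assms show ?thesis using mirror unfolding mirror_map_def by blast
qed

text \<open>
  At a boundary point of the domain the slope would be unbounded along sequences, and being increasing
  it could only tend to \<open>-\<infinity>\<close> at \<open>0\<close> from the right.
\<close>

lemma zero_I: "0 \<in> I"
proof (rule ccontr)
  assume "0 \<notin> I"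
  have X: "1 / real (n + 2) \<in> I" for n by (rule open_unit_I) auto
  have "(\<lambda>n. 1 / real (n + 2)) \<longlonglongrightarrow> 0"
    using LIMSEQ_ignore_initial_segment[OF lim_1_over_n, of 2] by simp
  then have lim: "filterlim (\<lambda>n. \<bar>dpsi \<psi> (1 / real (n + 2))\<bar>) at_top sequentially"
    using X \<open>0 \<notin> I\<close> unit_edom by (intro blowup) auto
  have "((\<lambda>x. ereal (dpsi \<psi> x)) \<longlongrightarrow> -\<infinity>) (at_right 0)"
    unfolding tendsto_MInfty
  proof
    fix r :: real
    have "eventually (\<lambda>n. \<bar>r\<bar> + \<bar>dpsi \<psi> (1/2)\<bar> + 1 \<le> \<bar>dpsi \<psi> (1 / real (n + 2))\<bar>) sequentially"
      using lim unfolding filterlim_at_top by blast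
    then obtain n where n: "\<bar>r\<bar> + \<bar>dpsi \<psi> (1/2)\<bar> + 1 \<le> \<bar>dpsi \<psi> (1 / real (n + 2))\<bar>"
      using eventually_happens by fastforce
    have half: "(1/2 :: real) \<in> I" by (rule open_unit_I) auto
    have "1 / real (n + 2) \<le> 1 / 2" by (simp add: field_simps)
    then have "dpsi \<psi> (1 / real (n + 2)) \<le> dpsi \<psi> (1/2)" using X half dpsi_le_iff by blast
    with n have small: "dpsi \<psi> (1 / real (n + 2)) < r" by linarith
    have "ereal (dpsi \<psi> x) < ereal r" if "x \<in> {0<..<1 / real (n + 2)}" for x
    proof -
      have "1 / real (n + 2) < 1" by simp
      then have "x < 1" using that by (meson greaterThanLessThan_iff order.strict_trans)
      then have "dpsi \<psi> x < dpsi \<psi> (1 / real (n + 2))"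
        using that X by (intro dpsi_less open_unit_I) auto
      with small show ?thesis by simp
    qed
    then show "eventually (\<lambda>x. ereal (dpsi \<psi> x) < ereal r) (at_right 0)"
      by (intro eventually_at_rightI[of 0 "1 / real (n + 2)"]) auto
  qed
  then have "dpsi_right \<psi> 0 = -\<infinity>"
    unfolding dpsi_right_def by (intro tendsto_Lim) simp_all
  with slope_0 show False by simp
qed

text \<open>
  At an interior point \<open>\<psi>'\<close> is continuous, so its one-sided limit would be finite.
\<close>

lemma one_not_I: "1 \<notin> I"
proof
  assume "1 \<in> I"
  then have "((\<lambda>x. ereal (dpsi \<psi> x)) \<longlongrightarrow> ereal (dpsi \<psi> 1)) (at_left 1)"
    using dpsi_continuous[of 1] by (auto simp: isCont_def intro: tendsto_within_subset)
  then have "dpsi_left \<psi> 1 = ereal (dpsi \<psi> 1)"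
    unfolding dpsi_left_def by (intro tendsto_Lim) simp_all
  with slope_1 show False by simp
qed

lemma unit_I: "0 \<le> x \<Longrightarrow> x < 1 \<Longrightarrow> x \<in> I"
  using zero_I open_unit_I by (cases "x = 0") auto

lemma I_less_1: "x \<in> I \<Longrightarrow> x < 1"
  using one_not_I between_I[OF zero_I, of x 1] by force

lemma dpsi_unbounded:
  obtains x0 where "0 \<le> x0" "x0 < 1" "\<And>x. x0 \<le> x \<Longrightarrow> x < 1 \<Longrightarrow> B < dpsi \<psi> x"
proof -
  let ?X = "\<lambda>n. 1 - 1 / real (n + 2)"
  have X: "?X n \<in> I" for n by (rule unit_I) auto
  have "(\<lambda>n. 1 - 1 / real (n + 2)) \<longlonglongrightarrow> 1 - 0"
    using LIMSEQ_ignore_initial_segment[OF lim_1_over_n, of 2] by (intro tendsto_intros) simp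
  then have "filterlim (\<lambda>n. \<bar>dpsi \<psi> (?X n)\<bar>) at_top sequentially"
    using X one_not_I unit_edom by (intro blowup) auto
  then have "eventually (\<lambda>n. \<bar>B\<bar> + \<bar>dpsi \<psi> 0\<bar> + 1 \<le> \<bar>dpsi \<psi> (?X n)\<bar>) sequentially"
    unfolding filterlim_at_top by blast
  then obtain n where n: "\<bar>B\<bar> + \<bar>dpsi \<psi> 0\<bar> + 1 \<le> \<bar>dpsi \<psi> (?X n)\<bar>"
    using eventually_happens by fastforce
  have "0 \<le> ?X n" by simp
  then have "dpsi \<psi> 0 \<le> dpsi \<psi> (?X n)" using X zero_I dpsi_le_iff by blast
  with n have big: "B < dpsi \<psi> (?X n)" by linarith
  show ?thesis
  proof (rule that[of "?X n"])
    fix x assume x: "?X n \<le> x" "x < 1"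
    with \<open>0 \<le> ?X n\<close> have "x \<in> I" by (intro unit_I) linarith+
    with x(1) X have "dpsi \<psi> (?X n) \<le> dpsi \<psi> x" using dpsi_le_iff by blast
    with big show "B < dpsi \<psi> x" by simp
  qed auto
qed

lemma dpsi_value_attained:
  assumes "dpsi \<psi> 0 \<le> y" obtains x where "0 \<le> x" "x < 1" "dpsi \<psi> x = y"
proof -
  obtain x0 where x0: "0 \<le> x0" "x0 < 1" "\<And>x. x0 \<le> x \<Longrightarrow> x < 1 \<Longrightarrow> y < dpsi \<psi> x"
    using dpsi_unbounded[of y] by metis
  have "\<exists>x\<ge>0. x \<le> x0 \<and> dpsi \<psi> x = y"
  proof (rule IVT')
    show "continuous_on {0..x0} (dpsi \<psi>)"
      using x0 by (intro continuous_at_imp_continuous_on ballI dpsi_continuous unit_I) auto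
    show "y \<le> dpsi \<psi> x0" using x0(3)[OF order_refl x0(2)] by simp
  qed (use assms x0 in auto)
  then show ?thesis using that x0(2) by force
qed

text \<open>
  The map \<open>\<chi>(u) = \<psi>'(1 - u)\<close> is decreasing, so \<open>\<chi>(b) \<ge> y\<close> means
  \<open>b \<le> \<chi>\<^sup>-\<^sup>1(y)\<close>; the lower bound on \<open>y\<close> places it in the range of \<open>\<chi>\<close>, where
  \<open>chi_inv\<close> is a genuine inverse.
\<close>

lemma chi_inv_upper:
  assumes b: "0 < b" "b \<le> 1" and y: "dpsi \<psi> 0 \<le> y" "y \<le> dpsi \<psi> (1 - b)"
  shows "b \<le> chi_inv \<psi> y"
proof -
  obtain x where x: "0 \<le> x" "x < 1" "dpsi \<psi> x = y" using dpsi_value_attained y(1) by blast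
  have "inj_on (\<lambda>x. dpsi \<psi> (1 - x)) {0<..1}"
  proof (rule inj_onI)
    fix u v :: real assume "u \<in> {0<..1}" "v \<in> {0<..1}" and eq: "dpsi \<psi> (1 - u) = dpsi \<psi> (1 - v)"
    then have "1 - u \<in> I" "1 - v \<in> I" by (auto intro: unit_I)
    with eq show "u = v" by (metis dpsi_le_iff order_antisym order_refl diff_diff_eq2 add_diff_cancel_left')
  qed
  moreover have "dpsi \<psi> (1 - (1 - x)) = y" using x by simp
  ultimately have "chi_inv \<psi> y = 1 - x"
    unfolding chi_inv_def using x by (intro the_inv_into_f_eq) auto
  moreover have "x \<le> 1 - b"
    using x b y(2) dpsi_le_iff[of x "1 - b"] unit_I by simp
  ultimately show ?thesis by simp
qed

lemma separable_real:
  assumes "\<And>a. p $ a \<in> edom \<psi>"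
  shows "real_of_ereal (separable \<psi> (p :: real ^ 'a::finite)) = (\<Sum>a\<in>UNIV. psir (p $ a))"
  unfolding separable_def using assms by (simp add: psi_eq_psir)

text \<open>
  The extended-real sum agrees with a sum of real functions only near a point all of whose coordinates
  are interior, which is enough for the gradient at that point.
\<close>

lemma grad_separable:
  fixes q :: "real ^ 'a::finite"
  assumes "\<And>a. q $ a \<in> I"
  shows "grad (\<lambda>x. real_of_ereal (separable \<psi> x)) q = (\<chi> a. dpsi \<psi> (q $ a))"
proof -
  let ?h = "\<lambda>x :: real ^ 'a. real_of_ereal (separable \<psi> x)"
  have "((\<lambda>x. psir (x $ a)) has_derivative (\<lambda>x. dpsi \<psi> (q $ a) * x $ a)) (at q)" for a
    using has_derivative_compose[OF bounded_linear_imp_has_derivative[OF bounded_linear_vec_nth]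
        psir_deriv[OF assms, unfolded has_field_derivative_def]] by simp
  then have "((\<lambda>x. \<Sum>a\<in>UNIV. psir (x $ a)) has_derivative (\<lambda>x. \<Sum>a\<in>UNIV. dpsi \<psi> (q $ a) * x $ a)) (at q)"
    by (intro has_derivative_sum) simp
  moreover have "eventually (\<lambda>x. (\<Sum>a\<in>UNIV. psir (x $ a)) = ?h x) (nhds q)"
  proof -
    have "eventually (\<lambda>x. x $ a \<in> I) (nhds q)" for a
      using assms[of a] by (intro topological_tendstoD[OF tendsto_vec_nth]) (auto simp: filterlim_ident)
    then have "eventually (\<lambda>x. \<forall>a. x $ a \<in> I) (nhds q)" by (rule eventually_all_finite)
    then show ?thesis
      by eventually_elim (simp add: separable_real I_edom)
  qed
  ultimately have "(?h has_derivative (\<lambda>x. \<Sum>a\<in>UNIV. dpsi \<psi> (q $ a) * x $ a)) (at q)"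
    unfolding eventually_nhds_conv_at by (elim has_derivative_transform_eventually conjE) auto
  then have G: "GDERIV ?h q :> (\<chi> a. dpsi \<psi> (q $ a))"
    by (simp add: gderiv_def inner_vec_def mult.commute)
  show ?thesis unfolding grad_def
  proof (rule the_equality)
    show "GDERIV ?h q :> (\<chi> a. dpsi \<psi> (q $ a))" by (rule G)
  next
    fix d assume "GDERIV ?h q :> d"
    then have "(\<lambda>h. inner h d) = (\<lambda>h. inner h (\<chi> a. dpsi \<psi> (q $ a)))"
      using G unfolding gderiv_def by (rule has_derivative_unique)
    then have "\<forall>h. inner h d = inner h (\<chi> a. dpsi \<psi> (q $ a))" by (blast dest: fun_cong)
    then show "d = (\<chi> a. dpsi \<psi> (q $ a))" by (rule iffD1[OF vector_eq_ldot])
  qed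
qed

lemma bregman_separable:
  assumes "\<And>a. p $ a \<in> edom \<psi>" "\<And>a. q $ a \<in> I"
  shows "bregman (separable \<psi>) p q
    = (\<Sum>a\<in>UNIV. psir (p $ a) - psir (q $ a) - dpsi \<psi> (q $ a) * (p $ a - q $ a))"
  unfolding bregman_def separable_real[of p, OF assms(1)] separable_real[of q, OF I_edom[OF assms(2)]]
    grad_separable[OF assms(2)]
  by (simp add: inner_vec_def sum_subtractf)

section \<open>One mirror step on the simplex\<close>

definition breg :: "real ^ 'a::finite \<Rightarrow> real ^ 'a \<Rightarrow> real" where
  "breg p q = (\<Sum>a\<in>UNIV. psir (p $ a) - psir (q $ a) - dpsi \<psi> (q $ a) * (p $ a - q $ a))"

lemma simplex_edom: "p \<in> prob_simplex \<Longrightarrow> p $ a \<in> edom \<psi>"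
  by (rule unit_edom) (simp_all add: prob_simplexD)

lemma breg_nonneg:
  assumes "p \<in> prob_simplex" "\<And>a. q $ a \<in> I" shows "0 \<le> breg p q"
  unfolding breg_def using tangent[OF assms(2) simplex_edom[OF assms(1)]]
  by (intro sum_nonneg) (simp add: algebra_simps)

lemma breg_self: "breg p p = 0" by (simp add: breg_def)

lemma breg_three_point:
  "breg r q - breg r p - breg p q = (\<Sum>a\<in>UNIV. (dpsi \<psi> (p $ a) - dpsi \<psi> (q $ a)) * (r $ a - p $ a))"
  unfolding breg_def sum_subtractf[symmetric] by (simp add: algebra_simps)

definition is_prox_step :: "real \<Rightarrow> real ^ 'a::finite \<Rightarrow> real ^ 'a \<Rightarrow> real ^ 'a \<Rightarrow> bool" where
  "is_prox_step \<eta> w q p \<longleftrightarrow>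
    is_arg_max (\<lambda>p. \<eta> * inner p w - bregman (separable \<psi>) p q) (\<lambda>p. p \<in> prob_simplex) p"

context
  fixes \<eta> :: real and w q p :: "real ^ 'a::finite"
  assumes q: "q \<in> prob_simplex" "\<And>a. q $ a \<in> I" and prox: "is_prox_step \<eta> w q p"
begin

lemma prox_simplex: "p \<in> prob_simplex"
  using prox by (simp add: is_prox_step_def is_arg_max_def)

lemma prox_max:
  assumes "r \<in> prob_simplex" shows "\<eta> * inner r w - breg r q \<le> \<eta> * inner p w - breg p q"
proof -
  have "bregman (separable \<psi>) r q = breg r q" if "r \<in> prob_simplex" for r
    unfolding breg_def by (intro bregman_separable simplex_edom that q(2))
  then show ?thesis
    using prox assms unfolding is_prox_step_def is_arg_max_def by (metis not_less)
qed

text \<open>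
  Shift a little mass \<open>e\<close> from \<open>a\<close> to \<open>b\<close>. The objective cannot increase, and replacing the
  increments of \<open>\<psi>\<close> by tangents at the shifted points turns this into an inequality between
  slopes. As these points lie in \<open>[0, 1)\<close>, the inequality holds even if \<open>p $ a\<close> is \<open>1\<close>,
  where \<open>\<psi>\<close> has no slope.
\<close>

lemma prox_exchange:
  assumes "a \<noteq> b" "0 < e" "e < p $ a"
  shows "\<eta> * w $ b - dpsi \<psi> (p $ b + e) + dpsi \<psi> (q $ b)
    \<le> \<eta> * w $ a - dpsi \<psi> (p $ a - e) + dpsi \<psi> (q $ a)"
proof -
  note p = prob_simplexD[OF prox_simplex]
  define r where "r = (\<chi> c. if c = a then p $ a - e else if c = b then p $ b + e else p $ c)"
  have ra: "r $ a = p $ a - e" and rb: "r $ b = p $ b + e"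
    and rc: "\<And>c. c \<noteq> a \<Longrightarrow> c \<noteq> b \<Longrightarrow> r $ c = p $ c"
    using assms(1) by (simp_all add: r_def)
  have two: "(\<Sum>c\<in>UNIV. F c) = F a + F b" if "\<And>c. c \<noteq> a \<Longrightarrow> c \<noteq> b \<Longrightarrow> F c = 0"
    for F :: "'a \<Rightarrow> real"
  proof -
    have "(\<Sum>c\<in>UNIV. F c) = (\<Sum>c\<in>{a, b}. F c)"
      by (rule sum.mono_neutral_right) (use that in auto)
    then show ?thesis using assms(1) by simp
  qed
  have "(\<Sum>c\<in>UNIV. r $ c - p $ c) = 0"
    by (subst two) (simp_all add: ra rb rc)
  moreover have "0 \<le> r $ c" for c using p(1) assms(2,3) by (simp add: r_def add_nonneg_nonneg)
  ultimately have r: "r \<in> prob_simplex" using p(2) by (simp add: prob_simplex_def sum_subtractf)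
  have "p $ a + p $ b \<le> 1"
    using sum_mono2[of UNIV "{a, b}" "\<lambda>c. p $ c"] p assms(1) by simp
  then have Ia: "p $ a - e \<in> I" and Ib: "p $ b + e \<in> I"
    using assms(2,3) p(1)[of b] p(1)[of a] by (auto intro!: unit_I)
  define F where "F c = \<eta> * w $ c * (r $ c - p $ c) - (psir (r $ c) - psir (p $ c))
    + dpsi \<psi> (q $ c) * (r $ c - p $ c)" for c
  have "(\<Sum>c\<in>UNIV. F c) = (\<eta> * inner r w - breg r q) - (\<eta> * inner p w - breg p q)"
    unfolding F_def breg_def inner_vec_def sum_distrib_left sum_subtractf[symmetric]
    by (rule sum.cong) (simp_all add: algebra_simps)
  then have "(\<Sum>c\<in>UNIV. F c) \<le> 0" using prox_max[OF r] by simp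
  then have le: "F a + F b \<le> 0" by (subst (asm) two) (simp_all add: F_def rc)
  have "dpsi \<psi> (p $ a - e) * e \<le> psir (p $ a) - psir (p $ a - e)"
    using tangent[OF Ia simplex_edom[OF prox_simplex], of a] by simp
  moreover have "dpsi \<psi> (p $ b + e) * (- e) \<le> psir (p $ b) - psir (p $ b + e)"
    using tangent[OF Ib simplex_edom[OF prox_simplex], of b] by simp
  ultimately have "e * ((\<eta> * w $ b - dpsi \<psi> (p $ b + e) + dpsi \<psi> (q $ b))
      - (\<eta> * w $ a - dpsi \<psi> (p $ a - e) + dpsi \<psi> (q $ a))) \<le> 0"
    using le by (simp add: F_def ra rb algebra_simps)
  then show ?thesis using assms(2) by (simp add: mult_le_0_iff)
qed

text \<open>
  If \<open>a\<close> had probability \<open>1\<close>, the slope at \<open>1 - e\<close> would be bounded as \<open>e\<close> tends to \<open>0\<close> by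
  the exchange inequality, contradicting steepness at \<open>1\<close>.
\<close>

lemma prox_interior: "p $ a \<in> I"
proof -
  note p = prob_simplexD[OF prox_simplex]
  have "p $ a \<noteq> 1"
  proof
    assume a: "p $ a = 1"
    have "q $ a < 1" by (rule I_less_1[OF q(2)])
    have "\<exists>b. b \<noteq> a"
    proof (rule ccontr)
      assume "\<nexists>b. b \<noteq> a"
      then have "UNIV = {a}" by blast
      have "(\<Sum>c\<in>{a}. q $ c) = 1"
        using prob_simplexD(2)[OF q(1)] unfolding \<open>UNIV = {a}\<close> .
      with \<open>q $ a < 1\<close> show False by simp
    qed
    then obtain b where b: "b \<noteq> a" by blast
    have "p $ a + p $ b \<le> 1"
      using sum_mono2[of UNIV "{a, b}" "\<lambda>c. p $ c"] p b by simp
    with a p(1)[of b] have pb: "p $ b = 0" by simp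
    \<comment> \<open>Upper bound that the exchange inequality gives for the slope at \<open>1 - e\<close> when \<open>e \<le> 1/2\<close>.\<close>
    define B where "B = \<eta> * w $ a + dpsi \<psi> (q $ a) - \<eta> * w $ b - dpsi \<psi> (q $ b) + dpsi \<psi> (1/2)"
    obtain x0 where x0: "0 \<le> x0" "x0 < 1" "\<And>x. x0 \<le> x \<Longrightarrow> x < 1 \<Longrightarrow> B < dpsi \<psi> x"
      using dpsi_unbounded[of B] by metis
    define e where "e = min (1/2) (1 - x0)"
    have e: "0 < e" "e \<le> 1/2" "e \<le> 1 - x0" using x0(1,2) by (simp_all add: e_def min_def)
    have "B < dpsi \<psi> (1 - e)" by (rule x0(3)) (use e in auto)
    moreover have "dpsi \<psi> e \<le> dpsi \<psi> (1/2)"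
      using e by (subst dpsi_le_iff) (auto intro: unit_I)
    ultimately show False
      using prox_exchange[of a b e] b e a pb by (simp add: B_def)
  qed
  with p(1,3)[of a] show ?thesis by (intro unit_I) auto
qed

text \<open>
  The limit of the exchange inequality as the shifted mass tends to \<open>0\<close>.
\<close>

lemma prox_optimality:
  assumes "0 < p $ a"
  shows "dpsi \<psi> (p $ a) - dpsi \<psi> (q $ a) - \<eta> * w $ a \<le> dpsi \<psi> (p $ b) - dpsi \<psi> (q $ b) - \<eta> * w $ b"
proof (cases "a = b")
  case False
  have cont: "((\<lambda>e. dpsi \<psi> (p $ c + u * e)) \<longlongrightarrow> dpsi \<psi> (p $ c + u * 0)) (at_right 0)" for c u
    using dpsi_continuous[OF prox_interior[of c]]
    by (intro isCont_tendsto_compose[of _ "dpsi \<psi>"] tendsto_intros) simp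
  have "\<eta> * w $ b - dpsi \<psi> (p $ b + 1 * 0) + dpsi \<psi> (q $ b)
      \<le> \<eta> * w $ a - dpsi \<psi> (p $ a + (-1) * 0) + dpsi \<psi> (q $ a)"
  proof (rule tendsto_le)
    show "((\<lambda>e. \<eta> * w $ b - dpsi \<psi> (p $ b + 1 * e) + dpsi \<psi> (q $ b))
      \<longlongrightarrow> \<eta> * w $ b - dpsi \<psi> (p $ b + 1 * 0) + dpsi \<psi> (q $ b)) (at_right 0)"
      by (intro tendsto_intros cont)
    show "((\<lambda>e. \<eta> * w $ a - dpsi \<psi> (p $ a + (-1) * e) + dpsi \<psi> (q $ a))
      \<longlongrightarrow> \<eta> * w $ a - dpsi \<psi> (p $ a + (-1) * 0) + dpsi \<psi> (q $ a)) (at_right 0)"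
      by (intro tendsto_intros cont)
    show "eventually (\<lambda>e. \<eta> * w $ b - dpsi \<psi> (p $ b + 1 * e) + dpsi \<psi> (q $ b)
        \<le> \<eta> * w $ a - dpsi \<psi> (p $ a + (-1) * e) + dpsi \<psi> (q $ a)) (at_right 0)"
      using prox_exchange[OF False] assms by (intro eventually_at_rightI[of 0 "p $ a"]) auto
  qed simp
  then show ?thesis by simp
qed simp

text \<open>
  The Karush-Kuhn-Tucker conditions: \<open>l\<close> is the multiplier of the constraint that probabilities sum
  to \<open>1\<close>, and the slack is the multiplier of the nonnegativity constraint, which vanishes on the
  support.
\<close>

lemma prox_multiplier:
  obtains l where "\<And>a. l \<le> dpsi \<psi> (p $ a) - dpsi \<psi> (q $ a) - \<eta> * w $ a"
    and "\<And>a. 0 < p $ a \<Longrightarrow> dpsi \<psi> (p $ a) - dpsi \<psi> (q $ a) - \<eta> * w $ a = l"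
proof -
  note p = prob_simplexD[OF prox_simplex]
  obtain a where a: "0 < p $ a"
  proof -
    have "\<exists>a. p $ a \<noteq> 0"
    proof (rule ccontr)
      assume "\<nexists>a. p $ a \<noteq> 0"
      with p(2) show False by simp
    qed
    then show ?thesis using p(1) that by (force simp: order_le_less)
  qed
  show ?thesis
    by (rule that[of "dpsi \<psi> (p $ a) - dpsi \<psi> (q $ a) - \<eta> * w $ a"])
      (use prox_optimality a in \<open>auto intro: antisym\<close>)
qed

lemma prox_three_point:
  assumes "r \<in> prob_simplex"
  shows "\<eta> * (\<Sum>a\<in>UNIV. (r $ a - p $ a) * w $ a) \<le> breg r q - breg r p - breg p q"
proof -
  note p = prob_simplexD[OF prox_simplex]
  obtain l where l: "\<And>a. l \<le> dpsi \<psi> (p $ a) - dpsi \<psi> (q $ a) - \<eta> * w $ a"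
    and l_eq: "\<And>a. 0 < p $ a \<Longrightarrow> dpsi \<psi> (p $ a) - dpsi \<psi> (q $ a) - \<eta> * w $ a = l"
    using prox_multiplier by blast
  have "l * (r $ a - p $ a) \<le> (dpsi \<psi> (p $ a) - dpsi \<psi> (q $ a) - \<eta> * w $ a) * (r $ a - p $ a)" for a
    using l[of a] l_eq[of a] p(1)[of a] prob_simplexD(1)[OF assms, of a]
    by (cases "0 < p $ a") (auto intro: mult_right_mono)
  then have "(\<Sum>a\<in>UNIV. l * (r $ a - p $ a))
      \<le> (\<Sum>a\<in>UNIV. (dpsi \<psi> (p $ a) - dpsi \<psi> (q $ a) - \<eta> * w $ a) * (r $ a - p $ a))"
    by (rule sum_mono)
  moreover have "(\<Sum>a\<in>UNIV. l * (r $ a - p $ a)) = 0"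
    using p(2) prob_simplexD(2)[OF assms] by (simp add: sum_distrib_left[symmetric] sum_subtractf)
  moreover have "(\<Sum>a\<in>UNIV. (dpsi \<psi> (p $ a) - dpsi \<psi> (q $ a) - \<eta> * w $ a) * (r $ a - p $ a))
      = (\<Sum>a\<in>UNIV. (dpsi \<psi> (p $ a) - dpsi \<psi> (q $ a)) * (r $ a - p $ a))
        - \<eta> * (\<Sum>a\<in>UNIV. (r $ a - p $ a) * w $ a)"
    unfolding sum_distrib_left sum_subtractf[symmetric] by (rule sum.cong) (simp_all add: algebra_simps)
  ultimately show ?thesis unfolding breg_three_point by linarith
qed

end
end

section \<open>Summability of the value errors\<close>

locale policy_mirror_descent = finite_mdp M + steep_mirror_map \<psi>
  for M :: "('s::finite, 'a::finite) mdp" and \<psi> +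
  fixes \<eta> :: real and \<pi> :: "nat \<Rightarrow> ('s, 'a) policy"
  assumes \<eta>: "0 < \<eta>" and pmd: "pmd M \<psi> \<eta> \<pi>"
begin

lemma pi_prox: "is_prox_step \<eta> (\<chi> a. Q M (\<pi> k) s a) (\<pi> k s) (\<pi> (Suc k) s)"
  using pmd by (simp add: pmd_def is_prox_step_def)

lemma iterate: "\<pi> k \<in> policies \<and> (\<forall>s a. \<pi> k s $ a \<in> I)"
proof (induction k)
  case 0 show ?case using pmd by (simp add: pmd_def)
next
  case (Suc k)
  then have "\<pi> k s \<in> prob_simplex" "\<And>a. \<pi> k s $ a \<in> I" for s by (auto simp: policiesD)
  from prox_simplex[OF this pi_prox] prox_interior[OF this pi_prox] show ?case
    by (auto simp: policies_def)
qed

lemma pi_policy: "\<pi> k \<in> policies" and pi_I: "\<pi> k s $ a \<in> I" and pi_simplex: "\<pi> k s \<in> prob_simplex"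
  using iterate by (auto simp: policiesD)

lemma pi_nonneg: "0 \<le> \<pi> k s $ a" and pi_sum: "(\<Sum>a\<in>UNIV. \<pi> k s $ a) = 1" and pi_less_1: "\<pi> k s $ a < 1"
  using prob_simplexD[OF pi_simplex] I_less_1[OF pi_I] by auto

abbreviation dual where "dual k s a \<equiv> dpsi \<psi> (\<pi> k s $ a)"
abbreviation err where "err k \<equiv> value_error M (\<pi> k)"

lemma step_optimality:
  "0 < \<pi> (Suc k) s $ a \<Longrightarrow>
    dual (Suc k) s a - dual k s a - \<eta> * Q M (\<pi> k) s a \<le> dual (Suc k) s b - dual k s b - \<eta> * Q M (\<pi> k) s b"
  using prox_optimality[OF pi_simplex pi_I pi_prox, where a = a and b = b] by simp

lemma step_multiplier:
  obtains l where "\<And>a. l \<le> dual (Suc k) s a - dual k s a - \<eta> * Q M (\<pi> k) s a"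
    and "\<And>a. 0 < \<pi> (Suc k) s $ a \<Longrightarrow> dual (Suc k) s a - dual k s a - \<eta> * Q M (\<pi> k) s a = l"
  by (rule prox_multiplier[OF pi_simplex pi_I pi_prox[of k s]]) auto

lemma step_three_point:
  assumes "r \<in> prob_simplex"
  shows "\<eta> * (\<Sum>a\<in>UNIV. (r $ a - \<pi> (Suc k) s $ a) * Q M (\<pi> k) s a) \<le> breg r (\<pi> k s) - breg r (\<pi> (Suc k) s)"
  using prox_three_point[OF pi_simplex pi_I pi_prox[of k s] assms] breg_nonneg[OF pi_simplex pi_I, of "Suc k" s k s]
  by simp

lemma step_improves: "V M (\<pi> k) s \<le> (\<Sum>a\<in>UNIV. \<pi> (Suc k) s $ a * Q M (\<pi> k) s a)"
proof -
  have "\<eta> * (\<Sum>a\<in>UNIV. (\<pi> k s $ a - \<pi> (Suc k) s $ a) * Q M (\<pi> k) s a) \<le> 0"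
    using step_three_point[OF pi_simplex, of k s k s] breg_nonneg[OF pi_simplex pi_I, of k s "Suc k" s]
    by (simp add: breg_self)
  then have "(\<Sum>a\<in>UNIV. (\<pi> k s $ a - \<pi> (Suc k) s $ a) * Q M (\<pi> k) s a) \<le> 0"
    using \<eta> by (simp add: mult_le_0_iff)
  then show ?thesis by (simp add: V_eq[OF pi_policy] left_diff_distrib sum_subtractf)
qed

lemma V_mono_Suc: "V M (\<pi> k) s \<le> V M (\<pi> (Suc k)) s"
  and improvement_le:
    "(\<Sum>a\<in>UNIV. \<pi> (Suc k) s $ a * Q M (\<pi> k) s a) - V M (\<pi> k) s \<le> V M (\<pi> (Suc k)) s - V M (\<pi> k) s"
  using policy_improvement[OF pi_policy step_improves] by auto

text \<open>
  Policy improvement at every step; this turns the bound at the first hitting time of \<open>\<sigma>\<close> into a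
  bound at all later times.
\<close>

lemma value_error_antimono: "k \<le> n \<Longrightarrow> err n \<le> err k"
proof (rule value_error_le)
  fix s assume "k \<le> n"
  then have "V M (\<pi> k) s \<le> V M (\<pi> n) s" by (rule lift_Suc_mono_le[of "\<lambda>k. V M (\<pi> k) s", OF V_mono_Suc])
  then show "\<bar>V_opt M s - V M (\<pi> n) s\<bar> \<le> err k"
    using V_opt_upper[OF pi_policy, of n s] value_error_ge[of s "\<pi> k"] by linarith
qed

text \<open>
  For an optimal policy \<open>\<rho>\<close>, the performance difference identity bounds \<open>V\<^sup>* - V\<^sup>\<pi>\<^sup>k\<close> by a discounted
  average of itself plus a one-step advantage. The advantage of \<open>\<rho>\<close> over the next iterate is a
  difference of divergences by the three-point inequality, and the advantage of the next iterate is at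
  most the increase of its value. Both telescope, so summing over \<open>k\<close> and applying
  \<open>contraction_bound\<close> to the partial sums bounds them independently of their length.
\<close>

lemma summable_value_error: "summable err"
proof -
  obtain \<rho> where \<rho>: "\<rho> \<in> policies" and V: "V_opt M = V M \<rho>" and Q: "Q_opt M = Q M \<rho>"
    by (rule optimal_policy)
  let ?W = "\<lambda>k s. V_opt M s - V M (\<pi> k) s"
  \<comment> \<open>Summing over all states makes the constant independent of the state.\<close>
  define C where "C = (\<Sum>s\<in>UNIV. breg (\<rho> s) (\<pi> 0 s) / \<eta> + V_opt M s - V M (\<pi> 0) s)"
  have W_nonneg: "0 \<le> ?W k s" for k s using V_opt_upper[OF pi_policy] by simp
  have step: "?W k s \<le> \<gamma> * (\<Sum>a\<in>UNIV. \<rho> s $ a * next_val M (?W k) s a)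
      + (breg (\<rho> s) (\<pi> k s) - breg (\<rho> s) (\<pi> (Suc k) s)) / \<eta> + (V M (\<pi> (Suc k)) s - V M (\<pi> k) s)" for k s
  proof -
    let ?S = "\<lambda>p. \<Sum>a\<in>UNIV. p $ a * Q M (\<pi> k) s a"
    have "\<eta> * (?S (\<rho> s) - ?S (\<pi> (Suc k) s)) \<le> breg (\<rho> s) (\<pi> k s) - breg (\<rho> s) (\<pi> (Suc k) s)"
      using step_three_point[OF policiesD[OF \<rho>], of s k s] by (simp add: left_diff_distrib sum_subtractf)
    then have "?S (\<rho> s) - ?S (\<pi> (Suc k) s) \<le> (breg (\<rho> s) (\<pi> k s) - breg (\<rho> s) (\<pi> (Suc k) s)) / \<eta>"
      using \<eta> by (simp add: field_simps)
    then show ?thesis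
      using performance_difference[OF \<rho>, of s "\<pi> k"] improvement_le[of k s] by (simp add: V)
  qed
  have bound: "(\<Sum>k<n. ?W k s) \<le> C / (1 - \<gamma>)" for n s
  proof (rule contraction_bound[OF \<rho>, where X = "\<lambda>s. \<Sum>k<n. ?W k s"])
    fix s
    have "(\<Sum>k<n. ?W k s) \<le> (\<Sum>k<n. \<gamma> * (\<Sum>a\<in>UNIV. \<rho> s $ a * next_val M (?W k) s a)
      + (breg (\<rho> s) (\<pi> k s) - breg (\<rho> s) (\<pi> (Suc k) s)) / \<eta> + (V M (\<pi> (Suc k)) s - V M (\<pi> k) s))"
      by (intro sum_mono step)
    also have "\<dots> = \<gamma> * (\<Sum>k<n. \<Sum>a\<in>UNIV. \<rho> s $ a * next_val M (?W k) s a)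
        + (breg (\<rho> s) (\<pi> 0 s) - breg (\<rho> s) (\<pi> n s)) / \<eta> + (V M (\<pi> n) s - V M (\<pi> 0) s)"
      by (simp add: sum.distrib sum_distrib_left[symmetric] sum_divide_distrib[symmetric]
          sum_lessThan_telescope[of "\<lambda>k. V M (\<pi> k) s"] sum_lessThan_telescope'[of "\<lambda>k. breg (\<rho> s) (\<pi> k s)"])
    also have "(\<Sum>k<n. \<Sum>a\<in>UNIV. \<rho> s $ a * next_val M (?W k) s a)
        = (\<Sum>a\<in>UNIV. \<rho> s $ a * next_val M (\<lambda>s. \<Sum>k<n. ?W k s) s a)"
      by (subst sum.swap) (simp add: sum_distrib_left[symmetric] next_val_sum)
    finally have le: "(\<Sum>k<n. ?W k s) \<le> \<gamma> * (\<Sum>a\<in>UNIV. \<rho> s $ a * next_val M (\<lambda>s. \<Sum>k<n. ?W k s) s a)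
        + (breg (\<rho> s) (\<pi> 0 s) - breg (\<rho> s) (\<pi> n s)) / \<eta> + (V M (\<pi> n) s - V M (\<pi> 0) s)" .
    have "(breg (\<rho> s) (\<pi> 0 s) - breg (\<rho> s) (\<pi> n s)) / \<eta> + (V M (\<pi> n) s - V M (\<pi> 0) s)
        \<le> breg (\<rho> s) (\<pi> 0 s) / \<eta> + V_opt M s - V M (\<pi> 0) s"
    proof -
      have "0 \<le> breg (\<rho> s) (\<pi> n s) / \<eta>" using \<eta> breg_nonneg[OF policiesD[OF \<rho>] pi_I] by simp
      then show ?thesis using V_opt_upper[OF pi_policy, of n s] by (simp add: diff_divide_distrib)
    qed
    also have "\<dots> \<le> C" unfolding C_def
    proof (rule member_le_sum)
      fix t :: 's
      have "0 \<le> breg (\<rho> t) (\<pi> 0 t) / \<eta>"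
        using \<eta> breg_nonneg[OF policiesD[OF \<rho>] pi_I, of t 0 t] by simp
      then show "0 \<le> breg (\<rho> t) (\<pi> 0 t) / \<eta> + V_opt M t - V M (\<pi> 0) t"
        using W_nonneg[of t 0] by linarith
    qed simp_all
    finally show "(\<Sum>k<n. ?W k s) \<le> C + \<gamma> * (\<Sum>a\<in>UNIV. \<rho> s $ a * next_val M (\<lambda>s. \<Sum>k<n. ?W k s) s a)"
      using le by linarith
  qed
  have "summable (\<lambda>k. ?W k s)" for s
    using bound[of s] W_nonneg by (intro summableI_nonneg_bounded) auto
  then have "summable (\<lambda>k. \<Sum>s\<in>UNIV. ?W k s)" by (intro summable_sum)
  moreover have "norm (err k) \<le> (\<Sum>s\<in>UNIV. ?W k s)" for k
  proof -
    have "err k \<le> (\<Sum>s\<in>UNIV. ?W k s)"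
      using W_nonneg by (intro value_error_le) (auto intro!: member_le_sum)
    moreover have "0 \<le> err k" by (simp add: value_error_def infnorm_pos_le)
    ultimately show ?thesis by simp
  qed
  ultimately show ?thesis by (rule summable_comparison_test'[where N = 0])
qed

end

section \<open>From dual iterates back to probabilities\<close>

lemma summable_increments:
  fixes y c :: "nat \<Rightarrow> real"
  assumes c: "summable c" and y: "\<And>k. T \<le> k \<Longrightarrow> \<bar>y (Suc k) - y k\<bar> \<le> c k"
  shows "convergent y" and "T \<le> k \<Longrightarrow> \<bar>y k - lim y\<bar> \<le> (\<Sum>t. c (t + k))"
proof -
  have *: "\<exists>l. y \<longlonglongrightarrow> l \<and> \<bar>y k - l\<bar> \<le> (\<Sum>t. c (t + k))" if "T \<le> k" for k
  proof -
    let ?z = "\<lambda>t. y (Suc t + k) - y (t + k)"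
    have le: "norm (?z t) \<le> c (t + k)" for t using y[of "t + k"] that by simp
    have sc: "summable (\<lambda>t. c (t + k))" using c by (rule summable_ignore_initial_segment)
    have sz: "summable ?z" by (rule summable_comparison_test'[OF sc]) (rule le)
    have "(\<lambda>n. \<Sum>t<n. ?z t) \<longlonglongrightarrow> suminf ?z" by (rule summable_LIMSEQ[OF sz])
    moreover have "(\<Sum>t<n. ?z t) = y (n + k) - y k" for n
      using sum_lessThan_telescope[of "\<lambda>t. y (t + k)" n] by simp
    ultimately have "(\<lambda>n. y (n + k) - y k) \<longlonglongrightarrow> suminf ?z" by simp
    then have "(\<lambda>n. y (n + k) - y k + y k) \<longlonglongrightarrow> suminf ?z + y k" by (intro tendsto_intros)
    then have "(\<lambda>n. y (n + k)) \<longlonglongrightarrow> suminf ?z + y k" by simp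
    then have "y \<longlonglongrightarrow> suminf ?z + y k" by (rule LIMSEQ_offset)
    moreover have "norm (suminf ?z) \<le> (\<Sum>t. c (t + k))"
      by (rule norm_suminf_le[OF le sc])
    ultimately show ?thesis by (intro exI[of _ "suminf ?z + y k"]) simp
  qed
  from *[of T] show "convergent y" by (auto simp: convergent_def)
  assume "T \<le> k"
  from *[OF this] show "\<bar>y k - lim y\<bar> \<le> (\<Sum>t. c (t + k))" by (auto dest: limI)
qed

context steep_mirror_map
begin

lemma dpsi_tendsto_cancel:
  assumes y: "\<And>k. 0 \<le> y k" "\<And>k. y k < 1" and p: "0 \<le> p" "p < 1"
    and lim: "((\<lambda>k. dpsi \<psi> (y k)) \<longlongrightarrow> dpsi \<psi> p) F"
  shows "(y \<longlongrightarrow> p) F"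
proof (rule order_tendstoI)
  fix u assume u: "u < p"
  show "eventually (\<lambda>k. u < y k) F"
  proof (cases "u < 0")
    case True then show ?thesis using y(1) by (intro always_eventually allI) (rule order_less_le_trans)
  next
    case False
    then have "dpsi \<psi> u < dpsi \<psi> p" using u p by (intro dpsi_less unit_I) auto
    from order_tendstoD(1)[OF lim this] show ?thesis
      by eventually_elim (use False u p y in \<open>simp add: dpsi_less_iff unit_I\<close>)
  qed
next
  fix u assume u: "p < u"
  show "eventually (\<lambda>k. y k < u) F"
  proof (cases "1 \<le> u")
    case True then show ?thesis using y(2) by (intro always_eventually allI) (rule order_less_le_trans)
  next
    case False
    then have "dpsi \<psi> p < dpsi \<psi> u" using u p by (intro dpsi_less unit_I) auto
    from order_tendstoD(2)[OF lim this] show ?thesis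
      by eventually_elim (use False u p y in \<open>simp add: dpsi_less_iff unit_I\<close>)
  qed
qed

text \<open>
  Near \<open>p\<close> the difference quotients of \<open>\<psi>'\<close> exceed half of the positive derivative at \<open>p\<close>, so
  distances of dual values control distances of probabilities.
\<close>

lemma dpsi_secant_bound:
  assumes "p \<in> I"
  shows "eventually (\<lambda>y. d2psi \<psi> p * \<bar>y - p\<bar> \<le> 2 * \<bar>dpsi \<psi> y - dpsi \<psi> p\<bar>) (nhds p)"
proof -
  let ?d = "d2psi \<psi> p"
  have "((\<lambda>y. (dpsi \<psi> y - dpsi \<psi> p) / (y - p)) \<longlongrightarrow> ?d) (at p)"
    using dpsi_deriv[OF assms] by (simp add: has_field_derivative_iff)
  moreover have "?d / 2 < ?d" using d2psi_pos[OF assms] by simp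
  ultimately have "eventually (\<lambda>y. ?d / 2 < (dpsi \<psi> y - dpsi \<psi> p) / (y - p)) (at p)"
    by (rule order_tendstoD)
  then have "eventually (\<lambda>y. ?d * \<bar>y - p\<bar> \<le> 2 * \<bar>dpsi \<psi> y - dpsi \<psi> p\<bar>) (at p)"
    using eventually_neq_at_within[of p p UNIV]
  proof eventually_elim
    fix y assume y: "?d / 2 < (dpsi \<psi> y - dpsi \<psi> p) / (y - p)" "y \<noteq> p"
    then have "?d / 2 \<le> \<bar>dpsi \<psi> y - dpsi \<psi> p\<bar> / \<bar>y - p\<bar>" unfolding abs_divide[symmetric] by linarith
    with y(2) show "?d * \<bar>y - p\<bar> \<le> 2 * \<bar>dpsi \<psi> y - dpsi \<psi> p\<bar>" by (simp add: field_simps)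
  qed
  then show ?thesis by (simp add: eventually_nhds_conv_at)
qed

end

section \<open>Growth of the dual gap\<close>

context policy_mirror_descent
begin

lemma dual_less_iff: "dual k s a < dual n s b \<longleftrightarrow> \<pi> k s $ a < \<pi> n s $ b"
  and dual_le_iff: "dual k s a \<le> dual n s b \<longleftrightarrow> \<pi> k s $ a \<le> \<pi> n s $ b"
  using dpsi_less_iff[OF pi_I pi_I] dpsi_le_iff[OF pi_I pi_I] by auto

lemma dual_ge: "dpsi \<psi> 0 \<le> dual k s a"
  using dpsi_le_iff[OF zero_I pi_I] pi_nonneg by blast

lemma subopt_mass_nonneg: "0 \<le> subopt_mass M (\<pi> k) s"
  unfolding subopt_mass_def by (rule sum_nonneg) (rule pi_nonneg)

lemma pi_le_subopt_mass: "a \<notin> opt_actions M s \<Longrightarrow> \<pi> k s $ a \<le> subopt_mass M (\<pi> k) s"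
  unfolding subopt_mass_def by (rule member_le_sum) (auto intro: pi_nonneg)

lemma opt_mass: "(\<Sum>a\<in>opt_actions M s. \<pi> k s $ a) = 1 - subopt_mass M (\<pi> k) s"
  unfolding subopt_mass_def
  using pi_sum[of k s] sum.subset_diff[of "opt_actions M s" UNIV "\<lambda>a. \<pi> k s $ a"]
  by (simp add: Compl_eq_Diff_UNIV)

lemma subopt_mass_pos_obtain:
  assumes "0 < subopt_mass M (\<pi> k) s"
  obtains b where "b \<notin> opt_actions M s" "0 < \<pi> k s $ b"
proof -
  have "\<exists>b. b \<notin> opt_actions M s \<and> \<pi> k s $ b \<noteq> 0"
  proof (rule ccontr)
    assume "\<nexists>b. b \<notin> opt_actions M s \<and> \<pi> k s $ b \<noteq> 0"
    then have "subopt_mass M (\<pi> k) s = 0" unfolding subopt_mass_def by (intro sum.neutral) auto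
    with assms show False by simp
  qed
  then obtain b where "b \<notin> opt_actions M s" "\<pi> k s $ b \<noteq> 0" by blast
  with pi_nonneg[of k s b] show ?thesis by (intro that[of b]) auto
qed

lemma value_error_nonneg: "0 \<le> err k" by (simp add: value_error_def infnorm_pos_le)

lemma value_error_eventually_small:
  assumes "0 < \<sigma>" shows "\<exists>T. \<forall>k\<ge>T. err k \<le> \<sigma>"
proof -
  have "err \<longlonglongrightarrow> 0" by (rule summable_LIMSEQ_zero[OF summable_value_error])
  from order_tendstoD(2)[OF this assms] show ?thesis
    unfolding eventually_sequentially by (meson less_imp_le)
qed

lemma err_after_T_hit:
  assumes "0 < \<sigma>" "T_hit M \<pi> \<sigma> \<le> k" shows "err k \<le> \<sigma>"
proof -
  obtain T where "err T \<le> \<sigma>" using value_error_eventually_small[OF assms(1)] by blast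
  then have "err (T_hit M \<pi> \<sigma>) \<le> \<sigma>" unfolding T_hit_def by (rule LeastI)
  with value_error_antimono[OF assms(2)] show ?thesis by simp
qed

lemma Q_bounds:
  shows "a \<in> opt_actions M s \<Longrightarrow> V_opt M s - err k \<le> Q M (\<pi> k) s a"
    and "Q M (\<pi> k) s a \<le> V_opt M s"
    and "s \<in> S_tilde M \<Longrightarrow> a \<notin> opt_actions M s \<Longrightarrow> Q M (\<pi> k) s a \<le> V_opt M s - gap M s"
  using Q_error_bounds[OF pi_policy[of k], of s a] Q_opt_le_V_opt[of s a] gap_pos_and_bound(2)[of s a]
  by (auto simp: opt_actions_def)

text \<open>
  Both actions receive the same multiplier, except that \<open>a\<close> may receive more if its probability
  becomes \<open>0\<close>; so the gap grows by at least \<open>\<eta>\<close> times the difference of the \<open>Q\<close>-values, which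
  is at least the optimality gap minus the value error.
\<close>

lemma dual_gap_step:
  assumes s: "s \<in> S_tilde M" and a: "a \<in> opt_actions M s" and b: "b \<notin> opt_actions M s"
    and pos: "0 < \<pi> (Suc k) s $ b"
  shows "dual k s a - dual k s b + \<eta> * (gap M s - err k) \<le> dual (Suc k) s a - dual (Suc k) s b"
proof -
  have "\<eta> * (gap M s - err k) \<le> \<eta> * (Q M (\<pi> k) s a - Q M (\<pi> k) s b)"
    using Q_bounds(1)[OF a, of k] Q_bounds(3)[OF s b, of k] \<eta> by (intro mult_left_mono) auto
  with step_optimality[OF pos, of a] show ?thesis by (simp add: algebra_simps)
qed

text \<open>
  Along a suboptimal action \<open>b\<close> that is in the support at time \<open>k + 1\<close> the gap grows by the
  previous lemma. If \<open>b\<close> is not in the support, its dual value is the smallest possible one, so its gap is at least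
  that of any suboptimal action \<open>c\<close> in the support. Therefore actions may leave and re-enter the
  support without spoiling the bound, provided some suboptimal action is left.
\<close>

lemma dual_gap_growth:
  assumes s: "s \<in> S_tilde M" and \<delta>: "\<And>j. T \<le> j \<Longrightarrow> \<delta> \<le> gap M s - err j"
    and base: "\<And>a b. a \<in> opt_actions M s \<Longrightarrow> b \<notin> opt_actions M s \<Longrightarrow> G0 \<le> dual T s a - dual T s b"
    and pos: "\<And>j. T < j \<Longrightarrow> j \<le> k \<Longrightarrow> 0 < subopt_mass M (\<pi> j) s"
    and "T \<le> k" "a \<in> opt_actions M s" "b \<notin> opt_actions M s"
  shows "G0 + real (k - T) * (\<eta> * \<delta>) \<le> dual k s a - dual k s b"
  using \<open>T \<le> k\<close> pos \<open>a \<in> opt_actions M s\<close> \<open>b \<notin> opt_actions M s\<close>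
proof (induction k arbitrary: a b rule: dec_induct)
  case base then show ?case using assms(3) by simp
next
  case (step k)
  obtain c where c: "c \<notin> opt_actions M s" "0 < \<pi> (Suc k) s $ c"
    using step.prems(1)[of "Suc k"] step.hyps subopt_mass_pos_obtain by auto
  have main: "G0 + real (Suc k - T) * (\<eta> * \<delta>) \<le> dual (Suc k) s a - dual (Suc k) s c"
    if c: "c \<notin> opt_actions M s" "0 < \<pi> (Suc k) s $ c" for c
  proof -
    have "G0 + real (k - T) * (\<eta> * \<delta>) \<le> dual k s a - dual k s c"
      using step.prems c(1) by (intro step.IH) auto
    moreover have "\<eta> * \<delta> \<le> \<eta> * (gap M s - err k)"
      using \<delta> step.hyps \<eta> by (intro mult_left_mono) auto
    ultimately show ?thesis
      using dual_gap_step[OF s step.prems(2) c] step.hyps by (simp add: Suc_diff_le algebra_simps)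
  qed
  show ?case
  proof (cases "0 < \<pi> (Suc k) s $ b")
    case True then show ?thesis using main step.prems(3) by blast
  next
    case False
    then have "dual (Suc k) s b \<le> dual (Suc k) s c" using c by (subst dual_le_iff) simp
    with main[OF c] show ?thesis by simp
  qed
qed

lemma G_le:
  assumes "a \<in> opt_actions M s" "b \<notin> opt_actions M s"
  shows "G M \<psi> (\<pi> k) s \<le> dual k s a - dual k s b"
proof -
  have "Min ((\<lambda>a. dpsi \<psi> (\<pi> k s $ a)) ` opt_actions M s) \<le> dual k s a" using assms by simp
  moreover have "dual k s b \<le> Max ((\<lambda>a. dpsi \<psi> (\<pi> k s $ a)) ` (- opt_actions M s))" using assms by simp
  ultimately show ?thesis unfolding G_def by simp
qed

lemma opt_increase_contradiction:
  assumes "subopt_mass M (\<pi> k) s = 0" "\<And>a. a \<in> opt_actions M s \<Longrightarrow> \<pi> k s $ a < \<pi> n s $ a"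
  shows False
proof -
  have "(\<Sum>a\<in>opt_actions M s. \<pi> k s $ a) < (\<Sum>a\<in>opt_actions M s. \<pi> n s $ a)"
    using assms(2) opt_actions_nonempty by (intro sum_strict_mono) auto
  then show False using assms(1) subopt_mass_nonneg[of n s] by (simp add: opt_mass)
qed

text \<open>
  A suboptimal action that re-enters gains dual value. Then every optimal action gains as well and
  increases its probability, although the optimal actions already have total mass \<open>1\<close>.
\<close>

lemma subopt_mass_absorbing:
  assumes s: "s \<in> S_tilde M" and zero: "subopt_mass M (\<pi> k) s = 0" and small: "err k \<le> gap M s"
  shows "subopt_mass M (\<pi> (Suc k)) s = 0"
proof (rule ccontr)
  assume "subopt_mass M (\<pi> (Suc k)) s \<noteq> 0"
  then have "0 < subopt_mass M (\<pi> (Suc k)) s" using subopt_mass_nonneg[of "Suc k" s] by simp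
  then obtain b where b: "b \<notin> opt_actions M s" "0 < \<pi> (Suc k) s $ b"
    by (rule subopt_mass_pos_obtain)
  have "\<pi> k s $ b = 0" using pi_le_subopt_mass[OF b(1), of k] zero pi_nonneg[of k s b] by simp
  then have "dual k s b < dual (Suc k) s b" using b(2) unfolding dual_less_iff by simp
  moreover have "0 \<le> \<eta> * (gap M s - err k)" using \<eta> small by simp
  ultimately have "\<pi> k s $ a < \<pi> (Suc k) s $ a" if "a \<in> opt_actions M s" for a
    using dual_gap_step[OF s that b] unfolding dual_less_iff[symmetric] by linarith
  with zero show False by (rule opt_increase_contradiction)
qed

text \<open>
  A single action never has probability \<open>1\<close>, so the suboptimal mass stays positive and
  \<open>dual_gap_growth\<close> applies at all times.
\<close>

lemma unique_opt_subopt_mass: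
  assumes "opt_actions M s = {a}"
  shows "subopt_mass M (\<pi> k) s = 1 - \<pi> k s $ a" "0 < subopt_mass M (\<pi> k) s"
  using opt_mass[of k s] pi_less_1[of k s a] assms by auto

lemma S_unique_S_tilde: "s \<in> S_unique M \<Longrightarrow> s \<in> S_tilde M"
proof -
  assume "s \<in> S_unique M"
  then obtain a where a: "opt_actions M s = {a}" by (auto simp: S_unique_def card_1_singleton_iff)
  show ?thesis using unique_opt_subopt_mass(2)[OF a, of 0] unfolding S_tilde_def subopt_mass_def
    by (auto simp: less_le)
qed

lemma S_unique_or_multi: "s \<in> S_unique M \<or> s \<in> S_multi M"
proof -
  have "card (opt_actions M s) \<noteq> 0" using opt_actions_nonempty by simp
  then show ?thesis unfolding S_unique_def S_multi_def mem_Collect_eq by linarith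
qed

text \<open>
  While the suboptimal mass is positive, the gap of every optimal action grows linearly. One of two
  optimal actions has probability at most \<open>1/2\<close>, so some gap is at most \<open>\<psi>'(1/2) - \<psi>'(0)\<close>, and the
  mass must vanish at some time; afterwards it remains zero.
\<close>

lemma T_stop_exists:
  assumes s: "s \<in> S_multi M" shows "\<exists>T. is_T_stop M \<pi> s T"
proof (cases "s \<in> S_tilde M")
  case False
  then show ?thesis by (auto simp: S_tilde_def is_T_stop_def subopt_mass_def)
next
  case tilde: True
  note gap_pos = gap_pos_and_bound(1)[OF tilde]
  obtain T where T: "\<And>k. T \<le> k \<Longrightarrow> err k \<le> gap M s / 2"
    using value_error_eventually_small[of "gap M s / 2"] gap_pos by auto
  obtain a1 a2 where a12: "a1 \<noteq> a2" "a1 \<in> opt_actions M s" "a2 \<in> opt_actions M s"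
    using s card_le_Suc0_iff_eq[of "opt_actions M s"] by (auto simp: S_multi_def not_le[symmetric])
  obtain b where b: "b \<notin> opt_actions M s" using tilde by (auto simp: S_tilde_def)
  have "\<exists>k\<ge>T. subopt_mass M (\<pi> k) s = 0"
  proof (rule ccontr)
    assume "\<not> (\<exists>k\<ge>T. subopt_mass M (\<pi> k) s = 0)"
    then have pos: "0 < subopt_mass M (\<pi> k) s" if "T \<le> k" for k
      using subopt_mass_nonneg[of k s] that by (auto simp: less_le)
    let ?B = "dpsi \<psi> (1/2) - dpsi \<psi> 0 - G M \<psi> (\<pi> T) s"
    have bound: "real n * (\<eta> * (gap M s / 2)) \<le> ?B" for n
    proof -
      have "(\<Sum>a\<in>{a1, a2}. \<pi> (T + n) s $ a) \<le> (\<Sum>a\<in>UNIV. \<pi> (T + n) s $ a)"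
        by (rule sum_mono2) (auto intro: pi_nonneg)
      then have "\<pi> (T + n) s $ a1 + \<pi> (T + n) s $ a2 \<le> 1" using a12(1) by (simp add: pi_sum)
      then have "\<exists>a\<in>opt_actions M s. \<pi> (T + n) s $ a \<le> 1/2" 
        using a12(2,3) by (cases "\<pi> (T + n) s $ a1 \<le> 1/2") (auto intro: bexI[of _ a1] bexI[of _ a2])
      then obtain a where a: "a \<in> opt_actions M s" "\<pi> (T + n) s $ a \<le> 1/2" by blast
      have "G M \<psi> (\<pi> T) s + real (T + n - T) * (\<eta> * (gap M s / 2)) \<le> dual (T + n) s a - dual (T + n) s b"
      proof (rule dual_gap_growth[OF tilde _ _ _ _ a(1) b])
        show "gap M s / 2 \<le> gap M s - err j" if "T \<le> j" for j using T[OF that] by simp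
      qed (auto intro: G_le pos)
      moreover have "dual (T + n) s a \<le> dpsi \<psi> (1/2)"
        using a(2) by (subst dpsi_le_iff) (auto intro: pi_I unit_I)
      ultimately show ?thesis using dual_ge[of "T + n" s b] by simp
    qed
    have "0 < \<eta> * (gap M s / 2)" using \<eta> gap_pos by simp
    then obtain n where "?B < real n * (\<eta> * (gap M s / 2))"
      using reals_Archimedean3 by blast
    with bound[of n] show False by simp
  qed
  then obtain K where K: "T \<le> K" "subopt_mass M (\<pi> K) s = 0" by blast
  have "subopt_mass M (\<pi> k) s = 0" if "K \<le> k" for k
    using that
  proof (induction k rule: dec_induct)
    case base show ?case by (rule K(2))
  next
    case (step k)
    have "err k \<le> gap M s" using T[of k] K(1) step.hyps gap_pos by simp
    with step.IH show ?case by (intro subopt_mass_absorbing tilde)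
  qed
  then show ?thesis by (auto simp: is_T_stop_def)
qed

section \<open>Convergence of the policies\<close>

text \<open>
  With \<open>l\<close> the multiplier of the step, \<open>l + \<eta> V\<^sup>*\<close> is the largest possible increment on the support.
  If it exceeded \<open>\<eta>\<close> times the value error, all optimal actions would gain probability; if it were
  negative, none of them would gain and those in the new support would lose. Neither is compatible with
  total mass \<open>1\<close> before and after the
  step.
\<close>

lemma dual_increment_bound:
  assumes "subopt_mass M (\<pi> k) s = 0" "subopt_mass M (\<pi> (Suc k)) s = 0"
  shows "\<bar>dual (Suc k) s a - dual k s a\<bar> \<le> \<eta> * err k"
proof (cases "a \<in> opt_actions M s")
  case False
  have "\<pi> j s $ a = 0" if "subopt_mass M (\<pi> j) s = 0" for j
    using pi_le_subopt_mass[OF False, of j] that pi_nonneg[of j s a] by simp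
  then show ?thesis using assms \<eta> value_error_nonneg[of k] by simp
next
  case a: True
  obtain l where l: "\<And>a. l \<le> dual (Suc k) s a - dual k s a - \<eta> * Q M (\<pi> k) s a"
    and l_eq: "\<And>a. 0 < \<pi> (Suc k) s $ a \<Longrightarrow> dual (Suc k) s a - dual k s a - \<eta> * Q M (\<pi> k) s a = l"
    by (rule step_multiplier[of k s]) blast
  have Q_lower: "\<eta> * V_opt M s - \<eta> * err k \<le> \<eta> * Q M (\<pi> k) s a" if "a \<in> opt_actions M s" for a
    using mult_left_mono[OF Q_bounds(1)[OF that, of k] less_imp_le[OF \<eta>]] by (simp add: right_diff_distrib)
  have Q_upper: "\<eta> * Q M (\<pi> k) s a \<le> \<eta> * V_opt M s" for a
    using \<eta> Q_bounds(2) by (intro mult_left_mono) auto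
  have upper: "l + \<eta> * V_opt M s \<le> \<eta> * err k"
  proof (rule ccontr)
    assume "\<not> ?thesis"
    then have "\<pi> k s $ a < \<pi> (Suc k) s $ a" if "a \<in> opt_actions M s" for a
      using l[of a] Q_lower[OF that] unfolding dual_less_iff[symmetric] by linarith
    with assms(1) show False by (rule opt_increase_contradiction)
  qed
  have lower: "0 \<le> l + \<eta> * V_opt M s"
  proof (rule ccontr)
    assume neg: "\<not> ?thesis"
    have "\<exists>c\<in>opt_actions M s. \<pi> (Suc k) s $ c \<noteq> 0"
    proof (rule ccontr)
      assume "\<not> ?thesis"
      then have "(\<Sum>c\<in>opt_actions M s. \<pi> (Suc k) s $ c) = 0" by (intro sum.neutral) auto
      then show False using assms(2) by (simp add: opt_mass)
    qed
    then obtain c where c: "c \<in> opt_actions M s" "0 < \<pi> (Suc k) s $ c"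
      using pi_nonneg by (auto simp: less_le)
    have less: "\<pi> (Suc k) s $ a < \<pi> k s $ a" if "0 < \<pi> (Suc k) s $ a" for a
      using l_eq[OF that] Q_upper[of a] neg unfolding dual_less_iff[symmetric] by linarith
    then have "\<pi> (Suc k) s $ a \<le> \<pi> k s $ a" for a
    proof (cases "0 < \<pi> (Suc k) s $ a")
      case True then show ?thesis using less[OF True] by simp
    next
      case False then show ?thesis using pi_nonneg[of k s a] by linarith
    qed
    then have "(\<Sum>a\<in>opt_actions M s. \<pi> (Suc k) s $ a) < (\<Sum>a\<in>opt_actions M s. \<pi> k s $ a)"
      using less[OF c(2)] c(1) by (intro sum_strict_mono_ex1) auto
    then show False using assms by (simp add: opt_mass)
  qed
  show ?thesis
  proof (cases "0 < \<pi> (Suc k) s $ a")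
    case True
    then show ?thesis using l_eq[OF True] Q_lower[OF a] Q_upper[of a] upper lower by linarith
  next
    case False
    then have "dual (Suc k) s a \<le> dual k s a"
      unfolding dual_le_iff using pi_nonneg[of k s a] by linarith
    then show ?thesis using l[of a] Q_lower[OF a] lower by linarith
  qed
qed

text \<open>
  The dual iterates have summable increments, hence finite limits; as every number from \<open>\<psi>'(0)\<close> on is
  a value of \<open>\<psi>'\<close> on \<open>[0, 1)\<close>, the probabilities converge to interior points.
\<close>

lemma multi_limit:
  assumes s: "s \<in> S_multi M"
  obtains p T where "(\<lambda>k. \<pi> k s) \<longlonglongrightarrow> p" "\<And>a. p $ a \<in> I"
    "\<And>k a. T \<le> k \<Longrightarrow> \<bar>dual k s a - dpsi \<psi> (p $ a)\<bar> \<le> \<eta> * (\<Sum>t. err (t + k))"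
proof -
  obtain T where T: "\<And>k. T \<le> k \<Longrightarrow> subopt_mass M (\<pi> k) s = 0"
    using T_stop_exists[OF s] by (auto simp: is_T_stop_def)
  have inc: "\<bar>dual (Suc k) s a - dual k s a\<bar> \<le> \<eta> * err k" if "T \<le> k" for k a
    using T that by (intro dual_increment_bound) auto
  note sum = summable_mult[OF summable_value_error, of \<eta>]
  have conv: "convergent (\<lambda>k. dual k s a)" for a
    by (rule summable_increments(1)[OF sum inc])
  have dist: "\<bar>dual k s a - lim (\<lambda>k. dual k s a)\<bar> \<le> (\<Sum>t. \<eta> * err (t + k))" if "T \<le> k" for k a
    by (rule summable_increments(2)[OF sum inc that])
  have "\<exists>p. 0 \<le> p \<and> p < 1 \<and> (\<lambda>k. dual k s a) \<longlonglongrightarrow> dpsi \<psi> p" for a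
  proof -
    obtain l where l: "(\<lambda>k. dual k s a) \<longlonglongrightarrow> l" using conv[of a] by (auto simp: convergent_def)
    have "dpsi \<psi> 0 \<le> l" by (rule LIMSEQ_le_const[OF l]) (auto intro: dual_ge)
    from dpsi_value_attained[OF this] l show ?thesis by metis
  qed
  then obtain q where q: "\<And>a. 0 \<le> q a" "\<And>a. q a < 1" "\<And>a. (\<lambda>k. dual k s a) \<longlonglongrightarrow> dpsi \<psi> (q a)"
    by metis
  show ?thesis
  proof (rule that[of "\<chi> a. q a" T])
    show "(\<lambda>k. \<pi> k s) \<longlonglongrightarrow> (\<chi> a. q a)"
      using dpsi_tendsto_cancel[OF pi_nonneg pi_less_1 q] by (intro vec_tendstoI) simp
    show "(\<chi> a. q a) $ a \<in> I" for a using q by (simp add: unit_I)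
    show "\<bar>dual k s a - dpsi \<psi> ((\<chi> a. q a) $ a)\<bar> \<le> \<eta> * (\<Sum>t. err (t + k))" if "T \<le> k" for k a
      using dist[OF that, of a] limI[OF q(3), of a]
        suminf_mult[OF summable_ignore_initial_segment[OF summable_value_error], of \<eta> k] by simp
  qed
qed

lemma unique_dual_growth:
  assumes s: "s \<in> S_unique M" and a: "opt_actions M s = {a}" and "0 < \<sigma>" and k: "T_hit M \<pi> \<sigma> \<le> k"
    and \<delta>: "\<delta> \<le> gap M s - \<sigma>"
  shows "dpsi \<psi> 0 + G M \<psi> (\<pi> (T_hit M \<pi> \<sigma>)) s + real (k - T_hit M \<pi> \<sigma>) * (\<eta> * \<delta>) \<le> dual k s a"
proof -
  have tilde: "s \<in> S_tilde M" by (rule S_unique_S_tilde[OF s])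
  then obtain b where b: "b \<notin> opt_actions M s" by (auto simp: S_tilde_def)
  have "G M \<psi> (\<pi> (T_hit M \<pi> \<sigma>)) s + real (k - T_hit M \<pi> \<sigma>) * (\<eta> * \<delta>) \<le> dual k s a - dual k s b"
  proof (rule dual_gap_growth[OF tilde _ _ _ k _ b])
    show "\<delta> \<le> gap M s - err j" if "T_hit M \<pi> \<sigma> \<le> j" for j
      using err_after_T_hit[OF \<open>0 < \<sigma>\<close> that] \<delta> by simp
  qed (auto simp: a unique_opt_subopt_mass[OF a] pi_less_1 intro!: G_le[unfolded a])
  with dual_ge[of k s b] show ?thesis by simp
qed

lemma unique_limit:
  assumes s: "s \<in> S_unique M" and a: "opt_actions M s = {a}"
  shows "(\<lambda>k. \<pi> k s) \<longlonglongrightarrow> axis a 1"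
proof -
  define \<sigma> where "\<sigma> = gap M s / 2"
  have \<sigma>: "0 < \<sigma>" using gap_pos_and_bound(1)[OF S_unique_S_tilde[OF s]] by (simp add: \<sigma>_def)
  let ?T = "T_hit M \<pi> \<sigma>"
  have a_lim: "(\<lambda>k. \<pi> k s $ a) \<longlonglongrightarrow> 1"
  proof (rule order_tendstoI)
    fix u :: real assume "1 < u"
    then show "eventually (\<lambda>k. \<pi> k s $ a < u) sequentially"
      by (intro always_eventually allI order.strict_trans[OF pi_less_1])
  next
    fix u :: real assume u: "u < 1"
    \<comment> \<open>Negative thresholds may lie outside the domain of \<open>\<psi>'\<close>.\<close>
    define v where "v = max u 0"
    have v: "v \<in> I" "u \<le> v" using u by (auto simp: v_def intro!: unit_I)
    have "0 < \<eta> * \<sigma>" using \<eta> \<sigma> by simp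
    then obtain n where n: "dpsi \<psi> v - dpsi \<psi> 0 - G M \<psi> (\<pi> ?T) s < real n * (\<eta> * \<sigma>)"
      using reals_Archimedean3 by blast
    have "u < \<pi> k s $ a" if k: "?T + n \<le> k" for k
    proof -
      have "real n * (\<eta> * \<sigma>) \<le> real (k - ?T) * (\<eta> * \<sigma>)"
        using k \<eta> \<sigma> by (intro mult_right_mono) auto
      then have "dpsi \<psi> v < dual k s a"
        using n unique_dual_growth[OF s a \<sigma>, of k \<sigma>] k by (simp add: \<sigma>_def)
      then show ?thesis using v dpsi_less_iff[OF v(1) pi_I] by force
    qed
    then show "eventually (\<lambda>k. u < \<pi> k s $ a) sequentially" unfolding eventually_sequentially by blast
  qed
  show ?thesis
  proof (rule vec_tendstoI)
    fix b
    show "(\<lambda>k. \<pi> k s $ b) \<longlonglongrightarrow> axis a 1 $ b"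
    proof (cases "b = a")
      case True then show ?thesis using a_lim by (simp add: axis_def)
    next
      case False
      have "(\<lambda>k. 1 - \<pi> k s $ a) \<longlonglongrightarrow> 1 - 1" by (intro tendsto_intros a_lim)
      then have mass: "(\<lambda>k. 1 - \<pi> k s $ a) \<longlonglongrightarrow> 0" by simp
      have "(\<lambda>k. \<pi> k s $ b) \<longlonglongrightarrow> 0"
      proof (rule tendsto_sandwich[OF _ _ tendsto_const mass])
        show "eventually (\<lambda>k. 0 \<le> \<pi> k s $ b) sequentially" by (simp add: pi_nonneg)
        show "eventually (\<lambda>k. \<pi> k s $ b \<le> 1 - \<pi> k s $ a) sequentially"
          using pi_le_subopt_mass[of b s] False
          by (simp add: a unique_opt_subopt_mass[OF a])
      qed
      then show ?thesis using False by (simp add: axis_def)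
    qed
  qed
qed

lemma policy_convergent: "convergent (\<lambda>k. \<pi> k s)"
proof (cases "s \<in> S_unique M")
  case True
  then obtain a where "opt_actions M s = {a}" by (auto simp: S_unique_def card_1_singleton_iff)
  with unique_limit[OF True] show ?thesis by (auto simp: convergent_def)
next
  case False
  then have "s \<in> S_multi M" using S_unique_or_multi by blast
  from multi_limit[OF this] show ?thesis unfolding convergent_def by metis
qed

text \<open>
  States with a unique optimal action belong to \<open>S_tilde\<close>, so \<open>min_gap_unique\<close> is at least
  \<open>min_gap\<close> and the linear term has positive slope.
\<close>

lemma T_tilde_exists:
  assumes ne: "S_unique M \<noteq> {}" and \<sigma>: "\<sigma> \<in> {0<..<min_gap M / 2}"
  shows "\<exists>T. is_T_tilde M \<psi> \<eta> \<pi> \<sigma> T"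
proof -
  let ?\<delta> = "min_gap_unique M - 2 * \<sigma>"
  have "min_gap M \<le> min_gap_unique M"
    unfolding min_gap_def min_gap_unique_def using ne S_unique_S_tilde by (intro Min_antimono) auto
  then have \<delta>: "0 < \<eta> * ?\<delta>" using \<sigma> \<eta> by simp
  then obtain n where n: "dpsi \<psi> 0 - C1 M \<psi> \<eta> \<pi> \<sigma> < real n * (\<eta> * ?\<delta>)"
    using reals_Archimedean3[OF \<delta>] by blast
  have "dpsi \<psi> 0 \<le> C1 M \<psi> \<eta> \<pi> \<sigma> + real k * \<eta> * ?\<delta>" if "n \<le> k" for k
  proof -
    have "real n * (\<eta> * ?\<delta>) \<le> real k * (\<eta> * ?\<delta>)" using that \<delta> by (intro mult_right_mono) auto
    with n show ?thesis by (simp add: mult.assoc)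
  qed
  then show ?thesis unfolding is_T_tilde_def by (intro exI[of _ "max n (T_hit M \<pi> \<sigma>)"]) auto
qed

lemma unique_rate:
  assumes s: "s \<in> S_unique M" and \<sigma>: "\<sigma> \<in> {0<..<min_gap M / 2}" and T: "is_T_tilde M \<psi> \<eta> \<pi> \<sigma> T" and k: "T \<le> k"
  shows "infnorm (\<pi> k s - limit_policy \<pi> s) \<le> subopt_mass M (\<pi> k) s"
    and "subopt_mass M (\<pi> k) s
      \<le> chi_inv \<psi> (real k * \<eta> * (min_gap_unique M - 2 * \<sigma>) + C1 M \<psi> \<eta> \<pi> \<sigma>)"
proof -
  obtain a where a: "opt_actions M s = {a}" using s by (auto simp: S_unique_def card_1_singleton_iff)
  let ?b = "subopt_mass M (\<pi> k) s" and ?\<delta> = "min_gap_unique M - 2 * \<sigma>"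
  note b = unique_opt_subopt_mass[OF a, of k]
  have lim: "limit_policy \<pi> s = axis a 1"
    unfolding limit_policy_def by (rule limI[OF unique_limit[OF s a]])
  show "infnorm (\<pi> k s - limit_policy \<pi> s) \<le> ?b"
  proof (rule infnorm_le_cart)
    fix c show "\<bar>(\<pi> k s - limit_policy \<pi> s) $ c\<bar> \<le> ?b"
      using pi_le_subopt_mass[of c s k] pi_nonneg[of k s c] pi_less_1[of k s a] b(1)
      by (cases "c = a") (auto simp: lim axis_def a)
  qed
  have "min_gap_unique M \<le> gap M s" unfolding min_gap_unique_def using s by simp
  then have \<delta>: "?\<delta> \<le> gap M s - \<sigma>" using \<sigma> by simp
  have Tk: "T_hit M \<pi> \<sigma> \<le> k" using T k by (simp add: is_T_tilde_def)
  have "C1 M \<psi> \<eta> \<pi> \<sigma> \<le> dpsi \<psi> 0 + G M \<psi> (\<pi> (T_hit M \<pi> \<sigma>)) s - \<eta> * real (T_hit M \<pi> \<sigma>) * ?\<delta>"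
    unfolding C1_def using s by (intro Min_le) auto
  moreover have "real (k - T_hit M \<pi> \<sigma>) * (\<eta> * ?\<delta>) = real k * \<eta> * ?\<delta> - \<eta> * real (T_hit M \<pi> \<sigma>) * ?\<delta>"
    using Tk by (simp add: of_nat_diff algebra_simps)
  ultimately have "real k * \<eta> * ?\<delta> + C1 M \<psi> \<eta> \<pi> \<sigma> \<le> dual k s a"
    using unique_dual_growth[OF s a _ Tk \<delta>] \<sigma> by simp
  moreover have "dpsi \<psi> 0 \<le> real k * \<eta> * ?\<delta> + C1 M \<psi> \<eta> \<pi> \<sigma>"
    using T k by (simp add: is_T_tilde_def add.commute)
  ultimately show "?b \<le> chi_inv \<psi> (real k * \<eta> * ?\<delta> + C1 M \<psi> \<eta> \<pi> \<sigma>)"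
    using b pi_nonneg[of k s a] by (intro chi_inv_upper) auto
qed

end

section \<open>Rates of convergence\<close>

definition min_curvature :: "real ^ 'a::finite \<Rightarrow> (real \<Rightarrow> real) \<Rightarrow> real" where
  "min_curvature p c = Min (range (\<lambda>a. c (p $ a)))"

definition max_curvature :: "real ^ 'a::finite \<Rightarrow> (real \<Rightarrow> real) \<Rightarrow> real" where
  "max_curvature p c = Max (range (\<lambda>a. c (p $ a)))"

lemma min_curvature_le: "min_curvature p c \<le> c (p $ a)"
  and max_curvature_ge: "c (p $ a) \<le> max_curvature p c"
  by (simp_all add: min_curvature_def max_curvature_def)

lemma curvature_pos:
  assumes "\<And>a. 0 < c (p $ a)"
  shows "0 < min_curvature p c" "0 < max_curvature p c"
proof -
  show "0 < min_curvature p c" using assms by (simp add: min_curvature_def)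
  then show "0 < max_curvature p c"
    using min_curvature_le[of p c] max_curvature_ge[of c p] by (meson order_less_le_trans)
qed

context policy_mirror_descent
begin

text \<open>
  For large \<open>k\<close> the secant bound turns the dual rate \<open>\<eta> \<Sum> err\<close> into \<open>2 \<eta> / L\<close> times the tail
  sum. Since \<open>L \<le> U\<close>, this is at most \<open>2 \<eta> U / L\<^sup>2\<close> times the tail sum, and the remaining terms
  of the stated bound are nonnegative.
\<close>

lemma multi_rate:
  assumes s: "s \<in> S_multi M"
  defines "U \<equiv> max_curvature (limit_policy \<pi> s) (d2psi \<psi>)"
    and "L \<equiv> min_curvature (limit_policy \<pi> s) (d2psi \<psi>)"
  shows "0 < U" "0 < L"
    and "\<exists>T3. \<forall>k\<ge>T3. infnorm (\<pi> k s - limit_policy \<pi> s)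
      \<le> U / L * subopt_mass M (\<pi> k) s
        + 2 * \<eta> * U / L\<^sup>2 * (1 + real CARD('a)) * (\<Sum>t. err (t + k))"
proof -
  obtain p T where lim: "(\<lambda>k. \<pi> k s) \<longlonglongrightarrow> p" and p: "\<And>a. p $ a \<in> I"
    and dist: "\<And>k a. T \<le> k \<Longrightarrow> \<bar>dual k s a - dpsi \<psi> (p $ a)\<bar> \<le> \<eta> * (\<Sum>t. err (t + k))"
    using multi_limit[OF s] by metis
  have p_eq: "limit_policy \<pi> s = p" unfolding limit_policy_def by (rule limI[OF lim])
  show U: "0 < U" and L: "0 < L"
    unfolding U_def L_def p_eq by (intro curvature_pos d2psi_pos p)+
  have LU: "L \<le> U"
    unfolding U_def L_def using min_curvature_le max_curvature_ge by (rule order_trans)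
  have "eventually (\<lambda>k. \<forall>a. d2psi \<psi> (p $ a) * \<bar>\<pi> k s $ a - p $ a\<bar> \<le> 2 * \<bar>dual k s a - dpsi \<psi> (p $ a)\<bar>) sequentially"
    using dpsi_secant_bound[OF p] tendsto_vec_nth[OF lim]
    by (intro eventually_all_finite) (rule eventually_compose_filterlim)
  then obtain N where N: "\<And>k a. N \<le> k \<Longrightarrow>
      d2psi \<psi> (p $ a) * \<bar>\<pi> k s $ a - p $ a\<bar> \<le> 2 * \<bar>dual k s a - dpsi \<psi> (p $ a)\<bar>"
    unfolding eventually_sequentially by blast
  have "infnorm (\<pi> k s - p)
      \<le> U / L * subopt_mass M (\<pi> k) s + 2 * \<eta> * U / L\<^sup>2 * (1 + real CARD('a)) * (\<Sum>t. err (t + k))"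
    if k: "max N T \<le> k" for k
  proof (rule infnorm_le_cart)
    fix a
    let ?S = "\<Sum>t. err (t + k)"
    have S: "0 \<le> ?S"
      by (intro suminf_nonneg summable_ignore_initial_segment summable_value_error) (rule value_error_nonneg)
    have "L * \<bar>\<pi> k s $ a - p $ a\<bar> \<le> d2psi \<psi> (p $ a) * \<bar>\<pi> k s $ a - p $ a\<bar>"
      unfolding L_def p_eq by (intro mult_right_mono min_curvature_le) simp
    also have "\<dots> \<le> 2 * (\<eta> * ?S)" using N[of k a] dist[of k a] k by simp
    finally have "\<bar>\<pi> k s $ a - p $ a\<bar> \<le> 2 * \<eta> * ?S * (1 / L)" using L by (simp add: field_simps)
    also have "\<dots> \<le> 2 * \<eta> * ?S * (U / L\<^sup>2)"
      using LU L S \<eta> by (intro mult_left_mono) (simp_all add: power2_eq_square field_simps)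
    also have "\<dots> = 2 * \<eta> * U / L\<^sup>2 * ?S" by simp
    also have "\<dots> \<le> 2 * \<eta> * U / L\<^sup>2 * (1 + real CARD('a)) * ?S"
    proof (rule mult_right_mono[OF _ S])
      have "2 * \<eta> * U / L\<^sup>2 * 1 \<le> 2 * \<eta> * U / L\<^sup>2 * (1 + real CARD('a))"
        using U L \<eta> by (intro mult_left_mono) simp_all
      then show "2 * \<eta> * U / L\<^sup>2 \<le> 2 * \<eta> * U / L\<^sup>2 * (1 + real CARD('a))" by simp
    qed
    also have "\<dots> \<le> U / L * subopt_mass M (\<pi> k) s + \<dots>"
      using U L subopt_mass_nonneg[of k s] by simp
    finally show "\<bar>(\<pi> k s - p) $ a\<bar> \<le> U / L * subopt_mass M (\<pi> k) s
        + 2 * \<eta> * U / L\<^sup>2 * (1 + real CARD('a)) * ?S" by simp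
  qed
  then show "\<exists>T3. \<forall>k\<ge>T3. infnorm (\<pi> k s - limit_policy \<pi> s)
      \<le> U / L * subopt_mass M (\<pi> k) s
        + 2 * \<eta> * U / L\<^sup>2 * (1 + real CARD('a)) * (\<Sum>t. err (t + k))"
    unfolding p_eq by blast
qed

end

theorem theorem3p15:
  "\<exists>U L :: real ^ 'a \<Rightarrow> (real \<Rightarrow> real) \<Rightarrow> real.
    \<forall>(M :: ('s::finite, 'a::finite) mdp) (\<psi> :: real \<Rightarrow> ereal) (\<eta> :: real) (\<pi> :: nat \<Rightarrow> ('s, 'a) policy).
      discounted_mdp M \<and> S_tilde M \<noteq> {} \<and> mirror_map \<psi> \<and> 0 < \<eta> \<and> pmd M \<psi> \<eta> \<pi> \<and>
      -\<infinity> < dpsi_right \<psi> 0 \<and> dpsi_left \<psi> 1 = \<infinity> \<and> S_unique M \<noteq> {} \<and>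
      (\<forall>x\<in>interior (edom \<psi>). dpsi \<psi> differentiable at x) \<and>
      continuous_on (interior (edom \<psi>)) (d2psi \<psi>) \<and>
      (\<forall>x\<in>interior (edom \<psi>). 0 < d2psi \<psi> x)
      \<longrightarrow>
      (\<forall>s. convergent (\<lambda>k. \<pi> k s)) \<and>
      (\<forall>s\<in>S_multi M. \<exists>T. is_T_stop M \<pi> s T) \<and>
      (\<forall>\<sigma>\<in>{0<..<min_gap M / 2}. \<exists>T. is_T_tilde M \<psi> \<eta> \<pi> \<sigma> T) \<and>
      (\<forall>s\<in>S_unique M. \<forall>\<sigma>\<in>{0<..<min_gap M / 2}. \<forall>T_tilde T_stop.
         is_T_tilde M \<psi> \<eta> \<pi> \<sigma> T_tilde \<and> (\<forall>s'\<in>S_multi M. is_T_stop M \<pi> s' (T_stop s')) \<longrightarrow>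
         (\<forall>k\<ge>T1 M T_tilde T_stop.
            infnorm (\<pi> k s - limit_policy \<pi> s) \<le> subopt_mass M (\<pi> k) s \<and>
            subopt_mass M (\<pi> k) s
              \<le> chi_inv \<psi> (real k * \<eta> * (min_gap_unique M - 2 * \<sigma>) + C1 M \<psi> \<eta> \<pi> \<sigma>))) \<and>
      (\<forall>s\<in>S_multi M.
         0 < U (limit_policy \<pi> s) (d2psi \<psi>) \<and> 0 < L (limit_policy \<pi> s) (d2psi \<psi>) \<and>
         (\<forall>\<sigma>\<in>{0<..<min_gap M / 2}. \<exists>T3. \<forall>k\<ge>T3.
            summable (\<lambda>t. value_error M (\<pi> (t + k))) \<and>
            infnorm (\<pi> k s - limit_policy \<pi> s)
              \<le> U (limit_policy \<pi> s) (d2psi \<psi>) / L (limit_policy \<pi> s) (d2psi \<psi>) * subopt_mass M (\<pi> k) s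
                + 2 * \<eta> * U (limit_policy \<pi> s) (d2psi \<psi>) / (L (limit_policy \<pi> s) (d2psi \<psi>))\<^sup>2
                  * (1 + real CARD('a)) * (\<Sum>t. value_error M (\<pi> (t + k)))))"
apply (rule exI[of _ max_curvature], rule exI[of _ min_curvature], intro allI impI)
  subgoal premises hyps for M \<psi> \<eta> \<pi>
  proof -
    interpret policy_mirror_descent M \<psi> \<eta> \<pi>
      using hyps by unfold_locales auto
    have ne: "S_unique M \<noteq> {}" using hyps by simp
    show ?thesis
    proof (intro conjI allI ballI impI)
      fix s show "convergent (\<lambda>k. \<pi> k s)" by (rule policy_convergent)
    next
      fix s assume "s \<in> S_multi M"
      then show "\<exists>T. is_T_stop M \<pi> s T" by (rule T_stop_exists)
    next
      fix \<sigma> assume "\<sigma> \<in> {0<..<min_gap M / 2}"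
      then show "\<exists>T. is_T_tilde M \<psi> \<eta> \<pi> \<sigma> T" by (rule T_tilde_exists[OF ne])
    next
      fix s \<sigma> T_tilde T_stop k
      assume s: "s \<in> S_unique M" and \<sigma>: "\<sigma> \<in> {0<..<min_gap M / 2}"
        and T: "is_T_tilde M \<psi> \<eta> \<pi> \<sigma> T_tilde \<and> (\<forall>s'\<in>S_multi M. is_T_stop M \<pi> s' (T_stop s'))"
        and k: "T1 M T_tilde T_stop \<le> k"
      have "T_tilde \<le> T1 M T_tilde T_stop" unfolding T1_def by (rule Max_ge) simp_all
      then have "T_tilde \<le> k" using k by simp
      then show "infnorm (\<pi> k s - limit_policy \<pi> s) \<le> subopt_mass M (\<pi> k) s"
        and "subopt_mass M (\<pi> k) s
          \<le> chi_inv \<psi> (real k * \<eta> * (min_gap_unique M - 2 * \<sigma>) + C1 M \<psi> \<eta> \<pi> \<sigma>)"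
        using unique_rate[OF s \<sigma> T[THEN conjunct1]] by blast+
    next
      fix s assume s: "s \<in> S_multi M"
      show "0 < max_curvature (limit_policy \<pi> s) (d2psi \<psi>)" by (rule multi_rate(1)[OF s])
      show "0 < min_curvature (limit_policy \<pi> s) (d2psi \<psi>)" by (rule multi_rate(2)[OF s])
    next
      fix s and \<sigma> :: real assume s: "s \<in> S_multi M"
      show "\<exists>T3. \<forall>k\<ge>T3.
            summable (\<lambda>t. value_error M (\<pi> (t + k))) \<and>
            infnorm (\<pi> k s - limit_policy \<pi> s)
              \<le> max_curvature (limit_policy \<pi> s) (d2psi \<psi>) / min_curvature (limit_policy \<pi> s) (d2psi \<psi>)
                  * subopt_mass M (\<pi> k) s
                + 2 * \<eta> * max_curvature (limit_policy \<pi> s) (d2psi \<psi>)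
                  / (min_curvature (limit_policy \<pi> s) (d2psi \<psi>))\<^sup>2
                  * (1 + real CARD('a)) * (\<Sum>t. value_error M (\<pi> (t + k)))"
        using multi_rate(3)[OF s] summable_ignore_initial_segment[OF summable_value_error] by blast
    qed
  qed
  done

end
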